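(* Let $\mathcal{C}$ be an additive category, and let $\mathcal{D}$ and $\mathcal{E}$ be exact structures on $\mathcal{C}$. (1) Assume that $\mathcal{C}$ has enough $\mathcal{D}$-injectives. Then the following are equivalent for an object $X$ of $\mathcal{C}$: (i) $X$ is $\mathcal{D}$-$\mathcal{E}$-divisible. (ii) There exists an $\mathcal{E}$-conflation $X\rightarrowtail Y\twoheadrightarrow Z$, where $Y$ is $\mathcal{D}$-injective. (iii) There exists an $\mathcal{E}$-conflation $X\rightarrowtail Y\twoheadrightarrow Z$, where $Y$ is $\mathcal{D}$-$\mathcal{E}$-divisible. If $\mathcal{E}$ is $\mathcal{D}$-injectively generated by a class of objects $\mathcal{M}$, then they are also equivalent to: (iv) For every object $M\in\mathcal{M}$, every morphism $X\to M$ factors through a $\mathcal{D}$-injective object. (2) Assume that $\mathcal{C}$ has enough $\mathcal{D}$-projectives. Then the following are equivalent for an object $Z$ of $\mathcal{C}$: (i) $Z$ is $\mathcal{D}$-$\mathcal{E}$-flat. (ii) There exists an $\mathcal{E}$-conflation $X\rightarrowtail Y\twoheadrightarrow Z$, where $Y$ is $\mathcal{D}$-projective. (iii) There exists an $\mathcal{E}$-conflation $X\rightarrowtail Y\twoheadrightarrow Z$, where $Y$ is $\mathcal{D}$-$\mathcal{E}$-flat. If $\mathcal{E}$ is $\mathcal{D}$-projectively generated by a class of objects $\mathcal{M}$, then they are also equivalent to: (iv) For every object $M\in\mathcal{M}$, every morphism $M\to Z$ factors through a $\mathcal{D}$-projective object.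
   Context: An exact structure $\mathcal{E}$ on an additive category $\mathcal{C}$ (Quillen, with Keller's axioms) is a distinguished class of kernel-cokernel pairs $X\rightarrowtail Y\twoheadrightarrow Z$, called $\mathcal{E}$-conflations (their kernels are $\mathcal{E}$-inflations, their cokernels $\mathcal{E}$-deflations), such that: $1_0$ is a deflation; deflations are closed under composition; pullbacks of deflations along arbitrary morphisms exist and are deflations; pushouts of inflations along arbitrary morphisms exist and are inflations. An object is $\mathcal{D}$-injective (resp. $\mathcal{D}$-projective) if every $\mathcal{D}$-conflation starting (resp. ending) with it splits. $\mathcal{C}$ has enough $\mathcal{D}$-injectives if every object $X$ admits a $\mathcal{D}$-conflation $X\rightarrowtail Y\twoheadrightarrow Z$ with $Y$ $\mathcal{D}$-injective, and enough $\mathcal{D}$-projectives if every object $Z$ admits a $\mathcal{D}$-conflation $X\rightarrowtail Y\twoheadrightarrow Z$ with $Y$ $\mathcal{D}$-projective. $\mathcal{E}$ is $\mathcal{D}$-projectively generated by a class $\mathcal{M}$ of objects if it consists of the $\mathcal{D}$-conflations $X\to Y\to Z$ such that $0\to\mathrm{Hom}(M,X)\to\mathrm{Hom}(M,Y)\to\mathrm{Hom}(M,Z)\to 0$ is exact for every $M\in\mathcal{M}$; it is $\mathcal{D}$-injectively generated by $\mathcal{M}$ if it consists of the $\mathcal{D}$-conflations $X\to Y\to Z$ such that $0\to\mathrm{Hom}(Z,M)\to\mathrm{Hom}(Y,M)\to\mathrm{Hom}(X,M)\to 0$ is exact for every $M\in\mathcal{M}$. An object $X$ is $\mathcal{D}$-$\mathcal{E}$-divisible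 if every $\mathcal{D}$-inflation $X\rightarrowtail Y$ is an $\mathcal{E}$-inflation, and $\mathcal{D}$-$\mathcal{E}$-flat if every $\mathcal{D}$-deflation $Y\twoheadrightarrow X$ is an $\mathcal{E}$-deflation. *)

theory Defs
  imports "HOL-Algebra.Exact_Sequence"
begin

section \<open>Additive categories\<close>

text \<open>The operation \<open>plus_mor\<close> is only meaningful on parallel morphisms, and \<open>cmp\<close>
  (written \<open>g \<cdot> f\<close>, first \<open>f\<close>, then \<open>g\<close>) only on composable ones.
  The type parameters are arbitrary, so \<open>obj\<close> is an arbitrary class of objects.\<close>

record ('o, 'm) addcat =
  obj :: "'o set"
  mor :: "'m set"
  src :: "'m \<Rightarrow> 'o"
  tgt :: "'m \<Rightarrow> 'o"
  cmp :: "'m \<Rightarrow> 'm \<Rightarrow> 'm"  (infixr "\<cdot>\<index>" 75)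
  idm :: "'o \<Rightarrow> 'm"
  plus_mor :: "'m \<Rightarrow> 'm \<Rightarrow> 'm"  (infixl "\<boxplus>\<index>" 65)
  zero_mor :: "'o \<Rightarrow> 'o \<Rightarrow> 'm"

definition Hom :: "('o, 'm, 'x) addcat_scheme \<Rightarrow> 'o \<Rightarrow> 'o \<Rightarrow> 'm set" where
  "Hom C X Y = {f \<in> mor C. src C f = X \<and> tgt C f = Y}"

definition Hom_group :: "('o, 'm, 'x) addcat_scheme \<Rightarrow> 'o \<Rightarrow> 'o \<Rightarrow> 'm monoid" where
  "Hom_group C X Y = \<lparr>carrier = Hom C X Y, monoid.mult = plus_mor C, one = zero_mor C X Y\<rparr>"

locale category =
  fixes C :: "('o, 'm, 'x) addcat_scheme" (structure)
  assumes src_obj: "f \<in> mor C \<Longrightarrow> src C f \<in> obj C"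
    and tgt_obj: "f \<in> mor C \<Longrightarrow> tgt C f \<in> obj C"
    and idm_Hom: "X \<in> obj C \<Longrightarrow> idm C X \<in> Hom C X X"
    and cmp_Hom: "f \<in> Hom C X Y \<Longrightarrow> g \<in> Hom C Y Z \<Longrightarrow> g \<cdot> f \<in> Hom C X Z"
    and cmp_idm: "f \<in> Hom C X Y \<Longrightarrow> f \<cdot> idm C X = f"
    and idm_cmp: "f \<in> Hom C X Y \<Longrightarrow> idm C Y \<cdot> f = f"
    and cmp_assoc: "f \<in> Hom C X Y \<Longrightarrow> g \<in> Hom C Y Z \<Longrightarrow> h \<in> Hom C Z W \<Longrightarrow>
      (h \<cdot> g) \<cdot> f = h \<cdot> (g \<cdot> f)"

definition is_zero_object :: "('o, 'm, 'x) addcat_scheme \<Rightarrow> 'o \<Rightarrow> bool" where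
  "is_zero_object C N \<longleftrightarrow> N \<in> obj C \<and>
     (\<forall>X\<in>obj C. (\<exists>!f. f \<in> Hom C X N) \<and> (\<exists>!f. f \<in> Hom C N X))"

text \<open>\<open>is_biproduct C X Z Y i s r d\<close>: \<open>Y\<close> is a direct sum of \<open>X\<close> and \<open>Z\<close> with injections
  \<open>i\<close>, \<open>s\<close> and projections \<open>r\<close>, \<open>d\<close>.\<close>

definition is_biproduct ::
  "('o, 'm, 'x) addcat_scheme \<Rightarrow> 'o \<Rightarrow> 'o \<Rightarrow> 'o \<Rightarrow> 'm \<Rightarrow> 'm \<Rightarrow> 'm \<Rightarrow> 'm \<Rightarrow> bool" where
  "is_biproduct C X Z Y i s r d \<longleftrightarrow>
     X \<in> obj C \<and> Z \<in> obj C \<and> Y \<in> obj C \<and>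
     i \<in> Hom C X Y \<and> s \<in> Hom C Z Y \<and> r \<in> Hom C Y X \<and> d \<in> Hom C Y Z \<and>
     r \<cdot>\<^bsub>C\<^esub> i = idm C X \<and> d \<cdot>\<^bsub>C\<^esub> s = idm C Z \<and>
     d \<cdot>\<^bsub>C\<^esub> i = zero_mor C X Z \<and> r \<cdot>\<^bsub>C\<^esub> s = zero_mor C Z X \<and>
     (i \<cdot>\<^bsub>C\<^esub> r) \<boxplus>\<^bsub>C\<^esub> (s \<cdot>\<^bsub>C\<^esub> d) = idm C Y"

locale additive_category = category C
  for C :: "('o, 'm, 'x) addcat_scheme" (structure) +
  assumes Hom_comm_group: "X \<in> obj C \<Longrightarrow> Y \<in> obj C \<Longrightarrow> comm_group (Hom_group C X Y)"
    and cmp_plus: "f \<in> Hom C X Y \<Longrightarrow> f' \<in> Hom C X Y \<Longrightarrow> g \<in> Hom C Y Z \<Longrightarrow>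
      g \<cdot> (f \<boxplus> f') = (g \<cdot> f) \<boxplus> (g \<cdot> f')"
    and plus_cmp: "f \<in> Hom C X Y \<Longrightarrow> g \<in> Hom C Y Z \<Longrightarrow> g' \<in> Hom C Y Z \<Longrightarrow>
      (g \<boxplus> g') \<cdot> f = (g \<cdot> f) \<boxplus> (g' \<cdot> f)"
    and ex_zero_object: "\<exists>N. is_zero_object C N"
    and ex_biproduct: "X \<in> obj C \<Longrightarrow> Z \<in> obj C \<Longrightarrow> \<exists>Y i s r d. is_biproduct C X Z Y i s r d"


section \<open>Kernels, cokernels, pullbacks and pushouts\<close>

definition is_kernel :: "('o, 'm, 'x) addcat_scheme \<Rightarrow> 'm \<Rightarrow> 'm \<Rightarrow> bool" where
  "is_kernel C i d \<longleftrightarrow> i \<in> mor C \<and> d \<in> mor C \<and> tgt C i = src C d \<and>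
     d \<cdot>\<^bsub>C\<^esub> i = zero_mor C (src C i) (tgt C d) \<and>
     (\<forall>f\<in>mor C. tgt C f = src C d \<and> d \<cdot>\<^bsub>C\<^esub> f = zero_mor C (src C f) (tgt C d) \<longrightarrow>
        (\<exists>!h. h \<in> Hom C (src C f) (src C i) \<and> i \<cdot>\<^bsub>C\<^esub> h = f))"

definition is_cokernel :: "('o, 'm, 'x) addcat_scheme \<Rightarrow> 'm \<Rightarrow> 'm \<Rightarrow> bool" where
  "is_cokernel C d i \<longleftrightarrow> i \<in> mor C \<and> d \<in> mor C \<and> tgt C i = src C d \<and>
     d \<cdot>\<^bsub>C\<^esub> i = zero_mor C (src C i) (tgt C d) \<and>
     (\<forall>f\<in>mor C. src C f = tgt C i \<and> f \<cdot>\<^bsub>C\<^esub> i = zero_mor C (src C i) (tgt C f) \<longrightarrow>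
        (\<exists>!h. h \<in> Hom C (tgt C d) (tgt C f) \<and> h \<cdot>\<^bsub>C\<^esub> d = f))"

definition kernel_cokernel_pair :: "('o, 'm, 'x) addcat_scheme \<Rightarrow> 'm \<Rightarrow> 'm \<Rightarrow> bool" where
  "kernel_cokernel_pair C i d \<longleftrightarrow> is_kernel C i d \<and> is_cokernel C d i"

text \<open>\<open>is_pullback C d f d' f'\<close>: the square \<open>d \<cdot> f' = f \<cdot> d'\<close> is a pullback,
  so \<open>d'\<close> is the pullback of \<open>d\<close> along \<open>f\<close>. Dually, in \<open>is_pushout C i f i' f'\<close>
  the morphism \<open>i'\<close> is the pushout of \<open>i\<close> along \<open>f\<close>.\<close>

definition is_pullback ::
  "('o, 'm, 'x) addcat_scheme \<Rightarrow> 'm \<Rightarrow> 'm \<Rightarrow> 'm \<Rightarrow> 'm \<Rightarrow> bool" where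
  "is_pullback C d f d' f' \<longleftrightarrow>
     d \<in> mor C \<and> f \<in> mor C \<and> d' \<in> mor C \<and> f' \<in> mor C \<and>
     tgt C d = tgt C f \<and> tgt C d' = src C f \<and> tgt C f' = src C d \<and> src C d' = src C f' \<and>
     d \<cdot>\<^bsub>C\<^esub> f' = f \<cdot>\<^bsub>C\<^esub> d' \<and>
     (\<forall>T\<in>obj C. \<forall>u\<in>Hom C T (src C d). \<forall>v\<in>Hom C T (src C f).
        d \<cdot>\<^bsub>C\<^esub> u = f \<cdot>\<^bsub>C\<^esub> v \<longrightarrow>
        (\<exists>!h. h \<in> Hom C T (src C d') \<and> f' \<cdot>\<^bsub>C\<^esub> h = u \<and> d' \<cdot>\<^bsub>C\<^esub> h = v))"

definition is_pushout ::
  "('o, 'm, 'x) addcat_scheme \<Rightarrow> 'm \<Rightarrow> 'm \<Rightarrow> 'm \<Rightarrow> 'm \<Rightarrow> bool" where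
  "is_pushout C i f i' f' \<longleftrightarrow>
     i \<in> mor C \<and> f \<in> mor C \<and> i' \<in> mor C \<and> f' \<in> mor C \<and>
     src C i = src C f \<and> src C i' = tgt C f \<and> src C f' = tgt C i \<and> tgt C i' = tgt C f' \<and>
     f' \<cdot>\<^bsub>C\<^esub> i = i' \<cdot>\<^bsub>C\<^esub> f \<and>
     (\<forall>T\<in>obj C. \<forall>u\<in>Hom C (tgt C i) T. \<forall>v\<in>Hom C (tgt C f) T.
        u \<cdot>\<^bsub>C\<^esub> i = v \<cdot>\<^bsub>C\<^esub> f \<longrightarrow>
        (\<exists>!h. h \<in> Hom C (tgt C i') T \<and> h \<cdot>\<^bsub>C\<^esub> f' = u \<and> h \<cdot>\<^bsub>C\<^esub> i' = v))"


section \<open>Exact structures\<close>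

text \<open>A class of conflations \<open>X \<rightarrowtail> Y \<twoheadrightarrow> Z\<close> is a set of pairs \<open>(i, d)\<close> of morphisms;
  the objects are recovered as sources and targets.\<close>

definition inflation :: "('m \<times> 'm) set \<Rightarrow> 'm \<Rightarrow> bool" where
  "inflation E i \<longleftrightarrow> (\<exists>d. (i, d) \<in> E)"

definition deflation :: "('m \<times> 'm) set \<Rightarrow> 'm \<Rightarrow> bool" where
  "deflation E d \<longleftrightarrow> (\<exists>i. (i, d) \<in> E)"

text \<open>Invariance of \<open>E\<close> under isomorphism of pairs is not imposed as a further condition.
  Inflations and deflations are invariant under isomorphism by the last two conditions,
  since pullbacks and pushouts are only determined up to isomorphism.\<close>

definition exact_structure ::
  "('o, 'm, 'x) addcat_scheme \<Rightarrow> ('m \<times> 'm) set \<Rightarrow> bool" where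
  "exact_structure C E \<longleftrightarrow>
     (\<forall>(i, d)\<in>E. kernel_cokernel_pair C i d) \<and>
     (\<forall>N. is_zero_object C N \<longrightarrow> deflation E (idm C N)) \<and>
     (\<forall>d e. deflation E d \<and> deflation E e \<and> tgt C d = src C e \<longrightarrow> deflation E (e \<cdot>\<^bsub>C\<^esub> d)) \<and>
     (\<forall>d f. deflation E d \<and> f \<in> mor C \<and> tgt C f = tgt C d \<longrightarrow>
        (\<exists>d' f'. is_pullback C d f d' f') \<and>
        (\<forall>d' f'. is_pullback C d f d' f' \<longrightarrow> deflation E d')) \<and>
     (\<forall>i f. inflation E i \<and> f \<in> mor C \<and> src C f = src C i \<longrightarrow>
        (\<exists>i' f'. is_pushout C i f i' f') \<and>
        (\<forall>i' f'. is_pushout C i f i' f' \<longrightarrow> inflation E i'))"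


section \<open>Injective, projective, divisible and flat objects\<close>

definition splits :: "('o, 'm, 'x) addcat_scheme \<Rightarrow> 'm \<Rightarrow> 'm \<Rightarrow> bool" where
  "splits C i d \<longleftrightarrow> (\<exists>s r. is_biproduct C (src C i) (tgt C d) (src C d) i s r d)"

definition injective_object ::
  "('o, 'm, 'x) addcat_scheme \<Rightarrow> ('m \<times> 'm) set \<Rightarrow> 'o \<Rightarrow> bool" where
  "injective_object C D X \<longleftrightarrow>
     X \<in> obj C \<and> (\<forall>(i, d)\<in>D. src C i = X \<longrightarrow> splits C i d)"

definition projective_object ::
  "('o, 'm, 'x) addcat_scheme \<Rightarrow> ('m \<times> 'm) set \<Rightarrow> 'o \<Rightarrow> bool" where
  "projective_object C D Z \<longleftrightarrow>
     Z \<in> obj C \<and> (\<forall>(i, d)\<in>D. tgt C d = Z \<longrightarrow> splits C i d)"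

definition enough_injectives ::
  "('o, 'm, 'x) addcat_scheme \<Rightarrow> ('m \<times> 'm) set \<Rightarrow> bool" where
  "enough_injectives C D \<longleftrightarrow>
     (\<forall>X\<in>obj C. \<exists>(i, d)\<in>D. src C i = X \<and> injective_object C D (tgt C i))"

definition enough_projectives ::
  "('o, 'm, 'x) addcat_scheme \<Rightarrow> ('m \<times> 'm) set \<Rightarrow> bool" where
  "enough_projectives C D \<longleftrightarrow>
     (\<forall>Z\<in>obj C. \<exists>(i, d)\<in>D. tgt C d = Z \<and> projective_object C D (src C d))"

definition divisible_object ::
  "('o, 'm, 'x) addcat_scheme \<Rightarrow> ('m \<times> 'm) set \<Rightarrow> ('m \<times> 'm) set \<Rightarrow> 'o \<Rightarrow> bool" where
  "divisible_object C D E X \<longleftrightarrow>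
     X \<in> obj C \<and> (\<forall>i. inflation D i \<and> src C i = X \<longrightarrow> inflation E i)"

definition flat_object ::
  "('o, 'm, 'x) addcat_scheme \<Rightarrow> ('m \<times> 'm) set \<Rightarrow> ('m \<times> 'm) set \<Rightarrow> 'o \<Rightarrow> bool" where
  "flat_object C D E X \<longleftrightarrow>
     X \<in> obj C \<and> (\<forall>d. deflation D d \<and> tgt C d = X \<longrightarrow> deflation E d)"


section \<open>Generated exact structures\<close>

definition short_exact :: "'a monoid \<Rightarrow> ('a \<Rightarrow> 'a) \<Rightarrow> 'a monoid \<Rightarrow> ('a \<Rightarrow> 'a) \<Rightarrow> 'a monoid \<Rightarrow> bool" where
  "short_exact A f B g K \<longleftrightarrow>
     exact_seq ([singleton_group (one K), K, B, A, singleton_group (one A)],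
       [\<lambda>_. one K, g, f, \<lambda>_. one A])"

definition Hom_from_exact :: "('o, 'm, 'x) addcat_scheme \<Rightarrow> 'o \<Rightarrow> 'm \<Rightarrow> 'm \<Rightarrow> bool" where
  "Hom_from_exact C M i d \<longleftrightarrow>
     short_exact (Hom_group C M (src C i)) (\<lambda>h. i \<cdot>\<^bsub>C\<^esub> h)
       (Hom_group C M (src C d)) (\<lambda>h. d \<cdot>\<^bsub>C\<^esub> h) (Hom_group C M (tgt C d))"

definition Hom_into_exact :: "('o, 'm, 'x) addcat_scheme \<Rightarrow> 'o \<Rightarrow> 'm \<Rightarrow> 'm \<Rightarrow> bool" where
  "Hom_into_exact C M i d \<longleftrightarrow>
     short_exact (Hom_group C (tgt C d) M) (\<lambda>h. h \<cdot>\<^bsub>C\<^esub> d)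
       (Hom_group C (src C d) M) (\<lambda>h. h \<cdot>\<^bsub>C\<^esub> i) (Hom_group C (src C i) M)"

definition projectively_generated ::
  "('o, 'm, 'x) addcat_scheme \<Rightarrow> ('m \<times> 'm) set \<Rightarrow> ('m \<times> 'm) set \<Rightarrow> 'o set \<Rightarrow> bool" where
  "projectively_generated C D E \<M> \<longleftrightarrow>
     \<M> \<subseteq> obj C \<and> E = {(i, d). (i, d) \<in> D \<and> (\<forall>M\<in>\<M>. Hom_from_exact C M i d)}"

definition injectively_generated ::
  "('o, 'm, 'x) addcat_scheme \<Rightarrow> ('m \<times> 'm) set \<Rightarrow> ('m \<times> 'm) set \<Rightarrow> 'o set \<Rightarrow> bool" where
  "injectively_generated C D E \<M> \<longleftrightarrow>
     \<M> \<subseteq> obj C \<and> E = {(i, d). (i, d) \<in> D \<and> (\<forall>M\<in>\<M>. Hom_into_exact C M i d)}"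

definition factors_through :: "('o, 'm, 'x) addcat_scheme \<Rightarrow> 'm \<Rightarrow> 'o \<Rightarrow> bool" where
  "factors_through C f W \<longleftrightarrow>
     (\<exists>g\<in>Hom C (src C f) W. \<exists>h\<in>Hom C W (tgt C f). f = h \<cdot>\<^bsub>C\<^esub> g)"

end

theory Submission
  imports Defs
begin

text \<open>
  Part (2): a \<open>\<D>\<close>-projective object is flat because every split epimorphism is an \<open>\<E>\<close>-deflation.
  If \<open>d : Y \<rightarrow> Z\<close> is an \<open>\<E>\<close>-deflation with \<open>Y\<close> flat and \<open>e : W \<rightarrow> Z\<close> a \<open>\<D>\<close>-deflation, the pullback \<open>e'\<close> of
  \<open>e\<close> along \<open>d\<close> is an \<open>\<E>\<close>-deflation, so \<open>d e'\<close> is one and it factors through \<open>e\<close>; as \<open>e\<close> has a kernel,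
  Quillen's obscure axiom makes \<open>e\<close> an \<open>\<E>\<close>-deflation. For (iv), a morphism \<open>M \<rightarrow> P \<rightarrow> Z\<close> with \<open>P\<close>
  projective lifts along every \<open>\<D>\<close>-deflation onto \<open>Z\<close>.

  Part (1) is part (2) in the opposite category. Keller's axioms are not visibly self-dual: that
  inflations compose is derived from the obscure axiom for deflations.
\<close>

section \<open>Calculus in additive categories\<close>

lemma Hom_iff: "f \<in> Hom C X Y \<longleftrightarrow> f \<in> mor C \<and> src C f = X \<and> tgt C f = Y"
  by (auto simp: Hom_def)

section \<open>Composition and identities\<close>

context category
begin

lemma cmp_mor [simp]:
  assumes "f \<in> mor C" "g \<in> mor C" "src C g = tgt C f"
  shows "g \<cdot> f \<in> mor C" "src C (g \<cdot> f) = src C f" "tgt C (g \<cdot> f) = tgt C g"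
  using cmp_Hom[of f "src C f" "tgt C f" g "tgt C g"] assms by (auto simp: Hom_iff)

lemma src_tgt_obj [simp]: "f \<in> mor C \<Longrightarrow> src C f \<in> obj C" "f \<in> mor C \<Longrightarrow> tgt C f \<in> obj C"
  by (auto intro: src_obj tgt_obj)

lemma idm_mor [simp]: "X \<in> obj C \<Longrightarrow> idm C X \<in> mor C"
  "X \<in> obj C \<Longrightarrow> src C (idm C X) = X" "X \<in> obj C \<Longrightarrow> tgt C (idm C X) = X"
  using idm_Hom[of X] by (auto simp: Hom_iff)

lemma idm_simps [simp]: "f \<in> mor C \<Longrightarrow> src C f = X \<Longrightarrow> f \<cdot> idm C X = f"
  "f \<in> mor C \<Longrightarrow> tgt C f = X \<Longrightarrow> idm C X \<cdot> f = f"
  by (auto intro: cmp_idm idm_cmp simp: Hom_iff)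

lemma assoc: "f \<in> mor C \<Longrightarrow> g \<in> mor C \<Longrightarrow> h \<in> mor C \<Longrightarrow> src C g = tgt C f \<Longrightarrow>
    src C h = tgt C g \<Longrightarrow> (h \<cdot> g) \<cdot> f = h \<cdot> (g \<cdot> f)"
  by (auto intro: cmp_assoc simp: Hom_iff)

text \<open>\<open>assoc\<close> nests composites to the right, so an equation for
  \<open>g \<cdot> f\<close> no longer matches once \<open>x\<close> is precomposed. This form
  rewrites the nested composite.\<close>

lemma cmp_reduce:
  assumes "g \<cdot> f = h" "x \<in> mor C" "f \<in> mor C" "g \<in> mor C" "src C f = tgt C x" "src C g = tgt C f"
  shows "g \<cdot> (f \<cdot> x) = h \<cdot> x"
  using assms(1) assoc[OF assms(2-6)] by simp

end

text \<open>The signature has no negation, so it is the inverse in the Hom group, whose two objects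
  are read off the morphism.\<close>

definition neg_mor :: "('o, 'm, 'x) addcat_scheme \<Rightarrow> 'm \<Rightarrow> 'm" where
  "neg_mor C f = inv\<^bsub>Hom_group C (src C f) (tgt C f)\<^esub> f"

section \<open>Hom groups and bilinearity of composition\<close>

context additive_category
begin

lemma zero_mor_mor [simp]:
  assumes "X \<in> obj C" "Y \<in> obj C"
  shows "zero_mor C X Y \<in> mor C" "src C (zero_mor C X Y) = X" "tgt C (zero_mor C X Y) = Y"
proof -
  interpret comm_group "Hom_group C X Y" using assms by (rule Hom_comm_group)
  show "zero_mor C X Y \<in> mor C" "src C (zero_mor C X Y) = X" "tgt C (zero_mor C X Y) = Y"
    using one_closed by (auto simp: Hom_group_def Hom_iff)
qed

context
  fixes f g :: 'm
  assumes f: "f \<in> mor C" and g: "g \<in> mor C" and par: "src C g = src C f" "tgt C g = tgt C f"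
begin

interpretation H: comm_group "Hom_group C (src C f) (tgt C f)"
  using f by (intro Hom_comm_group) auto

lemma plus_mor_mor [simp]: "f \<boxplus> g \<in> mor C" "src C (f \<boxplus> g) = src C f" "tgt C (f \<boxplus> g) = tgt C f"
  using H.m_closed[of f g] f g par by (auto simp: Hom_group_def Hom_iff)

lemma plus_mor_comm: "f \<boxplus> g = g \<boxplus> f"
  using H.m_comm[of f g] f g par by (auto simp: Hom_group_def Hom_iff)

lemma plus_mor_assoc:
  "h \<in> mor C \<Longrightarrow> src C h = src C f \<Longrightarrow> tgt C h = tgt C f \<Longrightarrow> (f \<boxplus> g) \<boxplus> h = f \<boxplus> (g \<boxplus> h)"
  using H.m_assoc[of f g h] f g par by (auto simp: Hom_group_def Hom_iff)

lemma plus_mor_cancel: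
  "h \<in> mor C \<Longrightarrow> src C h = src C f \<Longrightarrow> tgt C h = tgt C f \<Longrightarrow> f \<boxplus> g = f \<boxplus> h \<longleftrightarrow> g = h"
  using H.Units_l_cancel[of f g h] f g par H.Units_eq by (auto simp: Hom_group_def Hom_iff)

end

lemma plus_zero [simp]:
  assumes "f \<in> mor C" "src C f = X" "tgt C f = Y"
  shows "f \<boxplus> zero_mor C X Y = f" "zero_mor C X Y \<boxplus> f = f"
proof -
  interpret comm_group "Hom_group C X Y" using assms by (intro Hom_comm_group) auto
  show "f \<boxplus> zero_mor C X Y = f" "zero_mor C X Y \<boxplus> f = f"
    using r_one[of f] l_one[of f] assms by (auto simp: Hom_group_def Hom_iff)
qed

lemma neg_mor [simp]:
  assumes "f \<in> mor C"
  shows "neg_mor C f \<in> mor C" "src C (neg_mor C f) = src C f" "tgt C (neg_mor C f) = tgt C f"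
    "f \<boxplus> neg_mor C f = zero_mor C (src C f) (tgt C f)"
    "neg_mor C f \<boxplus> f = zero_mor C (src C f) (tgt C f)"
proof -
  interpret comm_group "Hom_group C (src C f) (tgt C f)" using assms by (intro Hom_comm_group) auto
  show "neg_mor C f \<in> mor C" "src C (neg_mor C f) = src C f" "tgt C (neg_mor C f) = tgt C f"
    "f \<boxplus> neg_mor C f = zero_mor C (src C f) (tgt C f)"
    "neg_mor C f \<boxplus> f = zero_mor C (src C f) (tgt C f)"
    using inv_closed[of f] r_inv[of f] l_inv[of f] assms
    by (auto simp: Hom_group_def Hom_iff neg_mor_def)
qed

lemma cmp_plus_mor:
  "f \<in> mor C \<Longrightarrow> f' \<in> mor C \<Longrightarrow> g \<in> mor C \<Longrightarrow> src C f' = src C f \<Longrightarrow> tgt C f' = tgt C f \<Longrightarrow>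
    src C g = tgt C f \<Longrightarrow> g \<cdot> (f \<boxplus> f') = (g \<cdot> f) \<boxplus> (g \<cdot> f')"
  by (rule cmp_plus) (auto simp: Hom_iff)

lemma plus_cmp_mor:
  "f \<in> mor C \<Longrightarrow> g \<in> mor C \<Longrightarrow> g' \<in> mor C \<Longrightarrow> src C g = tgt C f \<Longrightarrow> src C g' = tgt C f \<Longrightarrow>
    tgt C g' = tgt C g \<Longrightarrow> (g \<boxplus> g') \<cdot> f = (g \<cdot> f) \<boxplus> (g' \<cdot> f)"
  by (rule plus_cmp) (auto simp: Hom_iff)

text \<open>Adding a zero morphism to \<open>f\<close> also gives \<open>f\<close>, so cancellation
  applies. In this way additivity of composition yields the zero laws.\<close>

lemma idem_zero:
  assumes "f \<in> mor C" "f \<boxplus> f = f"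
  shows "f = zero_mor C (src C f) (tgt C f)"
  using plus_mor_cancel[of f f "zero_mor C (src C f) (tgt C f)"] assms by simp

lemma cmp_zero [simp]:
  assumes "g \<in> mor C" "X \<in> obj C" "src C g = Y"
  shows "g \<cdot> zero_mor C X Y = zero_mor C X (tgt C g)"
  using idem_zero[of "g \<cdot> zero_mor C X Y"] cmp_plus_mor[of "zero_mor C X Y" "zero_mor C X Y" g] assms
  by auto

lemma zero_cmp [simp]:
  assumes "g \<in> mor C" "Z \<in> obj C" "tgt C g = Y"
  shows "zero_mor C Y Z \<cdot> g = zero_mor C (src C g) Z"
  using idem_zero[of "zero_mor C Y Z \<cdot> g"] plus_cmp_mor[of g "zero_mor C Y Z" "zero_mor C Y Z"] assms
  by auto

text \<open>Both sides are additive inverses of \<open>g \<cdot> f\<close>, and inverses are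
  unique.\<close>

lemma neg_cmp:
  assumes "f \<in> mor C" "g \<in> mor C" "src C g = tgt C f"
  shows "neg_mor C g \<cdot> f = neg_mor C (g \<cdot> f)"
  using plus_mor_cancel[of "g \<cdot> f" "neg_mor C g \<cdot> f" "neg_mor C (g \<cdot> f)"] 
    plus_cmp_mor[of f g "neg_mor C g"] assms by simp

lemma cmp_neg:
  assumes "f \<in> mor C" "g \<in> mor C" "src C g = tgt C f"
  shows "g \<cdot> neg_mor C f = neg_mor C (g \<cdot> f)"
  using plus_mor_cancel[of "g \<cdot> f" "g \<cdot> neg_mor C f" "neg_mor C (g \<cdot> f)"] 
    cmp_plus_mor[of f "neg_mor C f" g] assms by simp

lemma plus_neg_cancel:
  assumes "f \<in> mor C" "g \<in> mor C" "src C g = src C f" "tgt C g = tgt C f"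
  shows "f \<boxplus> (neg_mor C f \<boxplus> g) = g"
  using plus_mor_assoc[of f "neg_mor C f" g] assms by simp

lemma zero_object_unique:
  assumes "is_zero_object C N" "f \<in> mor C" "g \<in> mor C" "src C g = src C f" "tgt C g = tgt C f"
    "src C f = N \<or> tgt C f = N"
  shows "f = g"
  using assms unfolding is_zero_object_def Hom_iff by (metis src_tgt_obj)

end

subsection \<open>Kernels, cokernels and biproducts\<close>

context additive_category
begin

section \<open>Universal properties of kernels and cokernels\<close>

lemma kernelD:
  assumes "is_kernel C i d"
  shows "i \<in> mor C" "d \<in> mor C" "tgt C i = src C d" "d \<cdot> i = zero_mor C (src C i) (tgt C d)"
  using assms by (auto simp: is_kernel_def)

lemma kernel_lift:
  assumes "is_kernel C i d" "f \<in> mor C" "tgt C f = src C d"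
    "d \<cdot> f = zero_mor C (src C f) (tgt C d)"
  obtains h where "h \<in> mor C" "src C h = src C f" "tgt C h = src C i" "i \<cdot> h = f"
  using assms unfolding is_kernel_def Hom_iff by metis

text \<open>Both \<open>g\<close> and \<open>h\<close> lift \<open>i \<cdot> g\<close>, which
  \<open>d\<close> kills, and lifts are unique.\<close>

lemma kernel_mono:
  assumes "is_kernel C i d" "g \<in> mor C" "h \<in> mor C" "src C g = src C h"
    "tgt C g = src C i" "tgt C h = src C i" "i \<cdot> g = i \<cdot> h"
  shows "g = h"
proof -
  note k = kernelD[OF assms(1)]
  have "d \<cdot> (i \<cdot> g) = zero_mor C (src C g) (tgt C d)"
    using k assms cmp_reduce[OF k(4), of g] by simp
  moreover have "\<forall>f\<in>mor C. tgt C f = src C d \<and> d \<cdot> f = zero_mor C (src C f) (tgt C d) \<longrightarrow>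
      (\<exists>!h. h \<in> Hom C (src C f) (src C i) \<and> i \<cdot> h = f)"
    using assms(1) by (simp add: is_kernel_def)
  ultimately have "\<exists>!h. h \<in> Hom C (src C (i \<cdot> g)) (src C i) \<and> i \<cdot> h = i \<cdot> g"
    using k(1,3) assms(2-6) cmp_mor[of g i] by metis
  then show ?thesis using assms k by (auto simp: Hom_iff)
qed

lemma kernelI:
  assumes "i \<in> mor C" "d \<in> mor C" "tgt C i = src C d" "d \<cdot> i = zero_mor C (src C i) (tgt C d)"
    and "\<And>f. f \<in> mor C \<Longrightarrow> tgt C f = src C d \<Longrightarrow> d \<cdot> f = zero_mor C (src C f) (tgt C d) \<Longrightarrow>
      \<exists>h\<in>mor C. src C h = src C f \<and> tgt C h = src C i \<and> i \<cdot> h = f"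
    and "\<And>g h. g \<in> mor C \<Longrightarrow> h \<in> mor C \<Longrightarrow> src C g = src C h \<Longrightarrow> tgt C g = src C i \<Longrightarrow>
      tgt C h = src C i \<Longrightarrow> i \<cdot> g = i \<cdot> h \<Longrightarrow> g = h"
  shows "is_kernel C i d"
  unfolding is_kernel_def Hom_iff using assms by (smt (verit))

lemma cokernelD:
  assumes "is_cokernel C d i"
  shows "i \<in> mor C" "d \<in> mor C" "tgt C i = src C d" "d \<cdot> i = zero_mor C (src C i) (tgt C d)"
  using assms by (auto simp: is_cokernel_def)

lemma cokernel_desc:
  assumes "is_cokernel C d i" "f \<in> mor C" "src C f = tgt C i"
    "f \<cdot> i = zero_mor C (src C i) (tgt C f)"
  obtains h where "h \<in> mor C" "src C h = tgt C d" "tgt C h = tgt C f" "h \<cdot> d = f"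
  using assms unfolding is_cokernel_def Hom_iff by metis

lemma cokernel_epi:
  assumes "is_cokernel C d i" "g \<in> mor C" "h \<in> mor C" "tgt C g = tgt C h"
    "src C g = tgt C d" "src C h = tgt C d" "g \<cdot> d = h \<cdot> d"
  shows "g = h"
proof -
  note k = cokernelD[OF assms(1)]
  have "(g \<cdot> d) \<cdot> i = zero_mor C (src C i) (tgt C g)"
    using k assms assoc[of i d g] by simp
  moreover have "\<forall>f\<in>mor C. src C f = tgt C i \<and> f \<cdot> i = zero_mor C (src C i) (tgt C f) \<longrightarrow>
      (\<exists>!h. h \<in> Hom C (tgt C d) (tgt C f) \<and> h \<cdot> d = f)"
    using assms(1) by (simp add: is_cokernel_def)
  ultimately have "\<exists>!h. h \<in> Hom C (tgt C d) (tgt C (g \<cdot> d)) \<and> h \<cdot> d = g \<cdot> d"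
    using k(2,3) assms(2-6) cmp_mor[of d g] by metis
  then show ?thesis using assms k by (auto simp: Hom_iff)
qed

lemma cokernelI:
  assumes "i \<in> mor C" "d \<in> mor C" "tgt C i = src C d" "d \<cdot> i = zero_mor C (src C i) (tgt C d)"
    and "\<And>f. f \<in> mor C \<Longrightarrow> src C f = tgt C i \<Longrightarrow> f \<cdot> i = zero_mor C (src C i) (tgt C f) \<Longrightarrow>
      \<exists>h\<in>mor C. src C h = tgt C d \<and> tgt C h = tgt C f \<and> h \<cdot> d = f"
    and "\<And>g h. g \<in> mor C \<Longrightarrow> h \<in> mor C \<Longrightarrow> tgt C g = tgt C h \<Longrightarrow> src C g = tgt C d \<Longrightarrow>
      src C h = tgt C d \<Longrightarrow> g \<cdot> d = h \<cdot> d \<Longrightarrow> g = h"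
  shows "is_cokernel C d i"
  unfolding is_cokernel_def Hom_iff using assms by (smt (verit))

text \<open>Each cokernel descends through the other; the two round trips are identities because
  cokernels are epimorphisms.\<close>

lemma cokernel_unique:
  assumes "is_cokernel C d i" "is_cokernel C d' i"
  obtains t s where "t \<in> mor C" "s \<in> mor C" "src C t = tgt C d'" "tgt C t = tgt C d"
    "src C s = tgt C d" "tgt C s = tgt C d'" "t \<cdot> d' = d" "s \<cdot> d = d'"
    "t \<cdot> s = idm C (tgt C d)" "s \<cdot> t = idm C (tgt C d')"
proof -
  note d = cokernelD[OF assms(1)] and d' = cokernelD[OF assms(2)]
  obtain t where t: "t \<in> mor C" "src C t = tgt C d'" "tgt C t = tgt C d" "t \<cdot> d' = d"
    using cokernel_desc[OF assms(2), of d] d by auto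
  obtain s where s: "s \<in> mor C" "src C s = tgt C d" "tgt C s = tgt C d'" "s \<cdot> d = d'"
    using cokernel_desc[OF assms(1), of d'] d' by auto
  have "t \<cdot> s = idm C (tgt C d)"
    by (rule cokernel_epi[OF assms(1)]) (use s t d in \<open>auto simp: assoc\<close>)
  moreover have "s \<cdot> t = idm C (tgt C d')"
    by (rule cokernel_epi[OF assms(2)]) (use s t d' in \<open>auto simp: assoc\<close>)
  ultimately show ?thesis using that s t by blast
qed

lemma kernel_unique:
  assumes "is_kernel C i d" "is_kernel C i' d"
  obtains t s where "t \<in> mor C" "s \<in> mor C" "src C t = src C i'" "tgt C t = src C i"
    "src C s = src C i" "tgt C s = src C i'" "i \<cdot> t = i'" "i' \<cdot> s = i"
    "t \<cdot> s = idm C (src C i)" "s \<cdot> t = idm C (src C i')"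
proof -
  note i = kernelD[OF assms(1)] and i' = kernelD[OF assms(2)]
  obtain t where t: "t \<in> mor C" "src C t = src C i'" "tgt C t = src C i" "i \<cdot> t = i'"
    using kernel_lift[OF assms(1), of i'] i' by auto
  obtain s where s: "s \<in> mor C" "src C s = src C i" "tgt C s = src C i'" "i' \<cdot> s = i"
    using kernel_lift[OF assms(2), of i] i by auto
  have "t \<cdot> s = idm C (src C i)"
    by (rule kernel_mono[OF assms(1)]) (use s t i cmp_reduce[OF t(4), of s] in auto)
  moreover have "s \<cdot> t = idm C (src C i')"
    by (rule kernel_mono[OF assms(2)]) (use s t i' cmp_reduce[OF s(4), of t] in auto)
  ultimately show ?thesis using that s t by blast
qed

section \<open>Universal properties of pullbacks and pushouts\<close>

lemma pullbackI:
  assumes "d \<in> mor C" "f \<in> mor C" "d' \<in> mor C" "f' \<in> mor C"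
    "tgt C d = tgt C f" "tgt C d' = src C f" "tgt C f' = src C d" "src C d' = src C f'"
    "d \<cdot> f' = f \<cdot> d'"
    and "\<And>u v. u \<in> mor C \<Longrightarrow> v \<in> mor C \<Longrightarrow> src C v = src C u \<Longrightarrow> tgt C u = src C d \<Longrightarrow>
      tgt C v = src C f \<Longrightarrow> d \<cdot> u = f \<cdot> v \<Longrightarrow>
      \<exists>h\<in>mor C. src C h = src C u \<and> tgt C h = src C d' \<and> f' \<cdot> h = u \<and> d' \<cdot> h = v"
    and "\<And>g h. g \<in> mor C \<Longrightarrow> h \<in> mor C \<Longrightarrow> src C g = src C h \<Longrightarrow> tgt C g = src C d' \<Longrightarrow>
      tgt C h = src C d' \<Longrightarrow> f' \<cdot> g = f' \<cdot> h \<Longrightarrow> d' \<cdot> g = d' \<cdot> h \<Longrightarrow> g = h"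
  shows "is_pullback C d f d' f'"
  unfolding is_pullback_def
proof (intro conjI ballI impI ex_ex1I)
  fix T u v assume uv: "T \<in> obj C" "u \<in> Hom C T (src C d)" "v \<in> Hom C T (src C f)" "d \<cdot> u = f \<cdot> v"
  then show "\<exists>h. h \<in> Hom C T (src C d') \<and> f' \<cdot> h = u \<and> d' \<cdot> h = v"
    using assms(10)[of u v] by (auto simp: Hom_iff)
  fix g h assume "g \<in> Hom C T (src C d') \<and> f' \<cdot> g = u \<and> d' \<cdot> g = v"
    "h \<in> Hom C T (src C d') \<and> f' \<cdot> h = u \<and> d' \<cdot> h = v"
  then show "g = h" using assms(11)[of g h] by (auto simp: Hom_iff)
qed (use assms in auto)

lemma pushoutI:
  assumes "i \<in> mor C" "f \<in> mor C" "i' \<in> mor C" "f' \<in> mor C"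
    "src C i = src C f" "src C i' = tgt C f" "src C f' = tgt C i" "tgt C i' = tgt C f'"
    "f' \<cdot> i = i' \<cdot> f"
    and "\<And>u v. u \<in> mor C \<Longrightarrow> v \<in> mor C \<Longrightarrow> tgt C v = tgt C u \<Longrightarrow> src C u = tgt C i \<Longrightarrow>
      src C v = tgt C f \<Longrightarrow> u \<cdot> i = v \<cdot> f \<Longrightarrow>
      \<exists>h\<in>mor C. src C h = tgt C i' \<and> tgt C h = tgt C u \<and> h \<cdot> f' = u \<and> h \<cdot> i' = v"
    and "\<And>g h. g \<in> mor C \<Longrightarrow> h \<in> mor C \<Longrightarrow> tgt C g = tgt C h \<Longrightarrow> src C g = tgt C i' \<Longrightarrow>
      src C h = tgt C i' \<Longrightarrow> g \<cdot> f' = h \<cdot> f' \<Longrightarrow> g \<cdot> i' = h \<cdot> i' \<Longrightarrow> g = h"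
  shows "is_pushout C i f i' f'"
  unfolding is_pushout_def
proof (intro conjI ballI impI ex_ex1I)
  fix T u v assume uv: "T \<in> obj C" "u \<in> Hom C (tgt C i) T" "v \<in> Hom C (tgt C f) T" "u \<cdot> i = v \<cdot> f"
  then show "\<exists>h. h \<in> Hom C (tgt C i') T \<and> h \<cdot> f' = u \<and> h \<cdot> i' = v"
    using assms(10)[of u v] by (auto simp: Hom_iff)
  fix g h assume "g \<in> Hom C (tgt C i') T \<and> g \<cdot> f' = u \<and> g \<cdot> i' = v"
    "h \<in> Hom C (tgt C i') T \<and> h \<cdot> f' = u \<and> h \<cdot> i' = v"
  then show "g = h" using assms(11)[of g h] by (auto simp: Hom_iff)
qed (use assms in auto)

lemma pushout_desc:
  assumes "is_pushout C i f i' f'" "u \<in> mor C" "v \<in> mor C" "tgt C v = tgt C u"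
    "src C u = tgt C i" "src C v = tgt C f" "u \<cdot> i = v \<cdot> f"
  obtains h where "h \<in> mor C" "src C h = tgt C i'" "tgt C h = tgt C u" "h \<cdot> f' = u" "h \<cdot> i' = v"
proof -
  have "\<exists>h. h \<in> Hom C (tgt C i') (tgt C u) \<and> h \<cdot> f' = u \<and> h \<cdot> i' = v"
    using assms unfolding is_pushout_def by (metis Hom_iff src_tgt_obj(2))
  then show ?thesis using that by (auto simp: Hom_iff)
qed

text \<open>\<open>g\<close> and \<open>h\<close> solve the same descent problem, with data
  \<open>g \<cdot> f'\<close> and \<open>g \<cdot> i'\<close>; the square makes these data
  compatible.\<close>

lemma pushout_ext:
  assumes "is_pushout C i f i' f'" "g \<in> mor C" "h \<in> mor C" "tgt C g = tgt C h"
    "src C g = tgt C i'" "src C h = tgt C i'" "g \<cdot> f' = h \<cdot> f'" "g \<cdot> i' = h \<cdot> i'"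
  shows "g = h"
proof -
  have *: "i \<in> mor C" "f \<in> mor C" "i' \<in> mor C" "f' \<in> mor C"
    "src C i = src C f" "src C i' = tgt C f" "src C f' = tgt C i" "tgt C i' = tgt C f'"
    "f' \<cdot> i = i' \<cdot> f"
    using assms(1) by (auto simp: is_pushout_def)
  have "(g \<cdot> f') \<cdot> i = (g \<cdot> i') \<cdot> f" using * assms(2-) by (simp add: assoc)
  then have "\<exists>!h. h \<in> Hom C (tgt C i') (tgt C g) \<and> h \<cdot> f' = g \<cdot> f' \<and> h \<cdot> i' = g \<cdot> i'"
    using assms(1) * assms(2-6) unfolding is_pushout_def
    by (simp add: Hom_iff)
  then show ?thesis using assms by (auto simp: Hom_iff)
qed

section \<open>Coordinates in a biproduct\<close>

lemma biproductD:
  assumes "is_biproduct C X Z Y i s r d"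
  shows "X \<in> obj C" "Z \<in> obj C" "Y \<in> obj C"
    "i \<in> mor C" "src C i = X" "tgt C i = Y" "s \<in> mor C" "src C s = Z" "tgt C s = Y"
    "r \<in> mor C" "src C r = Y" "tgt C r = X" "d \<in> mor C" "src C d = Y" "tgt C d = Z"
    "r \<cdot> i = idm C X" "d \<cdot> s = idm C Z" "d \<cdot> i = zero_mor C X Z" "r \<cdot> s = zero_mor C Z X"
    "(i \<cdot> r) \<boxplus> (s \<cdot> d) = idm C Y"
  using assms by (auto simp: is_biproduct_def Hom_iff)

text \<open>The four relations between injections and projections, precomposed with \<open>x\<close>
  so that they rewrite right-nested composites.\<close>

lemma biproduct_reduce:
  assumes "is_biproduct C X Z Y i s r d" "x \<in> mor C"
  shows "tgt C x = X \<Longrightarrow> r \<cdot> (i \<cdot> x) = x" "tgt C x = Z \<Longrightarrow> d \<cdot> (s \<cdot> x) = x"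
    "tgt C x = X \<Longrightarrow> d \<cdot> (i \<cdot> x) = zero_mor C (src C x) Z"
    "tgt C x = Z \<Longrightarrow> r \<cdot> (s \<cdot> x) = zero_mor C (src C x) X"
proof -
  note b = biproductD[OF assms(1)]
  show "tgt C x = X \<Longrightarrow> r \<cdot> (i \<cdot> x) = x" "tgt C x = Z \<Longrightarrow> d \<cdot> (s \<cdot> x) = x"
    "tgt C x = X \<Longrightarrow> d \<cdot> (i \<cdot> x) = zero_mor C (src C x) Z"
    "tgt C x = Z \<Longrightarrow> r \<cdot> (s \<cdot> x) = zero_mor C (src C x) X"
    using b assms(2) cmp_reduce[OF b(16), of x] cmp_reduce[OF b(17), of x]
      cmp_reduce[OF b(18), of x] cmp_reduce[OF b(19), of x] by auto
qed

lemma biproduct_expand: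
  assumes "is_biproduct C X Z Y i s r d" "x \<in> mor C" "tgt C x = Y"
  shows "x = (i \<cdot> (r \<cdot> x)) \<boxplus> (s \<cdot> (d \<cdot> x))"
proof -
  note b = biproductD[OF assms(1)]
  have "x = ((i \<cdot> r) \<boxplus> (s \<cdot> d)) \<cdot> x" using b assms by simp
  also have "\<dots> = (i \<cdot> (r \<cdot> x)) \<boxplus> (s \<cdot> (d \<cdot> x))"
    using b(1-19) assms by (simp add: plus_cmp_mor assoc)
  finally show ?thesis .
qed

lemma biproduct_ext:
  assumes "is_biproduct C X Z Y i s r d" "x \<in> mor C" "y \<in> mor C" "tgt C x = Y" "tgt C y = Y"
    "r \<cdot> x = r \<cdot> y" "d \<cdot> x = d \<cdot> y"
  shows "x = y"
  using biproduct_expand[OF assms(1)] assms by metis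

lemma biproduct_proj_epi:
  assumes "is_biproduct C X Z Y i s r d" "g \<in> mor C" "h \<in> mor C" "src C g = X" "src C h = X"
    "g \<cdot> r = h \<cdot> r"
  shows "g = h"
proof -
  have "(g \<cdot> r) \<cdot> i = g" "(h \<cdot> r) \<cdot> i = h"
    using biproductD[OF assms(1)] assms(2-5) by (simp_all add: assoc)
  then show ?thesis using assms(6) by metis
qed

text \<open>Needed for the opposite category, where the two summands of a split conflation change
  places.\<close>

lemma biproduct_swap:
  assumes "is_biproduct C X Z Y i s r d"
  shows "is_biproduct C Z X Y s i d r"
  using biproductD[OF assms] plus_mor_comm[of "i \<cdot> r" "s \<cdot> d"]
  by (auto simp: is_biproduct_def Hom_iff)

end

section \<open>Keller's consequences of the axioms\<close>

locale exact_category = additive_category C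
  for C :: "('o, 'm, 'x) addcat_scheme" (structure) +
  fixes E :: "('m \<times> 'm) set"
  assumes exact: "exact_structure C E"
begin

section \<open>The axioms of an exact structure as separate rules\<close>

lemma exact_structureD:
  shows "\<forall>(i, d)\<in>E. kernel_cokernel_pair C i d"
    and "\<forall>N. is_zero_object C N \<longrightarrow> deflation E (idm C N)"
    and "\<forall>d e. deflation E d \<and> deflation E e \<and> tgt C d = src C e \<longrightarrow> deflation E (e \<cdot> d)"
    and "\<forall>d f. deflation E d \<and> f \<in> mor C \<and> tgt C f = tgt C d \<longrightarrow>
      (\<exists>d' f'. is_pullback C d f d' f') \<and> (\<forall>d' f'. is_pullback C d f d' f' \<longrightarrow> deflation E d')"
    and "\<forall>i f. inflation E i \<and> f \<in> mor C \<and> src C f = src C i \<longrightarrow>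
      (\<exists>i' f'. is_pushout C i f i' f') \<and> (\<forall>i' f'. is_pushout C i f i' f' \<longrightarrow> inflation E i')"
  by (insert exact, unfold exact_structure_def, (elim conjE, assumption)+)

lemma conflationD:
  assumes "(i, d) \<in> E"
  shows "is_kernel C i d" "is_cokernel C d i"
  using exact_structureD(1) assms by (auto simp: kernel_cokernel_pair_def)

lemma conflationI: "(i, d) \<in> E \<Longrightarrow> inflation E i" "(i, d) \<in> E \<Longrightarrow> deflation E d"
  by (auto simp: inflation_def deflation_def)

lemma deflation_idm_zero: "is_zero_object C N \<Longrightarrow> deflation E (idm C N)"
  using exact_structureD(2) by blast

lemma deflation_cmp: "deflation E d \<Longrightarrow> deflation E e \<Longrightarrow> tgt C d = src C e \<Longrightarrow> deflation E (e \<cdot> d)"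
  using exact_structureD(3) by blast

lemma deflation_pullback:
  assumes "deflation E d" "is_pullback C d f d' f'"
  shows "deflation E d'"
proof -
  have "f \<in> mor C" "tgt C f = tgt C d" using assms(2) by (auto simp: is_pullback_def)
  then show ?thesis using exact_structureD(4)[rule_format, of d f] assms by blast
qed

lemma ex_pullback:
  "deflation E d \<Longrightarrow> f \<in> mor C \<Longrightarrow> tgt C f = tgt C d \<Longrightarrow> \<exists>d' f'. is_pullback C d f d' f'"
  using exact_structureD(4)[rule_format, of d f] by blast

lemma inflation_pushout:
  assumes "inflation E i" "is_pushout C i f i' f'"
  shows "inflation E i'"
proof -
  have "f \<in> mor C" "src C f = src C i" using assms(2) by (auto simp: is_pushout_def)
  then show ?thesis using exact_structureD(5)[rule_format, of i f] assms by blast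
qed

lemma ex_pushout:
  "inflation E i \<Longrightarrow> f \<in> mor C \<Longrightarrow> src C f = src C i \<Longrightarrow> \<exists>i' f'. is_pushout C i f i' f'"
  using exact_structureD(5)[rule_format, of i f] by blast

section \<open>Inflations and deflations do not depend on the choice of kernel or cokernel\<close>

lemma cokernel_deflation:
  assumes "inflation E i" "is_cokernel C d i"
  shows "deflation E d"
proof -
  obtain d' where E: "(i, d') \<in> E" using assms(1) by (auto simp: inflation_def)
  note d' = conflationD(2)[OF E]
  obtain t s where ts: "t \<in> mor C" "s \<in> mor C" "src C t = tgt C d'" "tgt C t = tgt C d"
    "src C s = tgt C d" "tgt C s = tgt C d'" "t \<cdot> d' = d" "s \<cdot> d = d'"
    "t \<cdot> s = idm C (tgt C d)" "s \<cdot> t = idm C (tgt C d')"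
    using cokernel_unique[OF assms(2) d'] by blast
  note m = cokernelD[OF d'] cokernelD[OF assms(2)]
  \<comment> \<open>The two cokernels differ by the isomorphism \<open>s\<close>, so
    \<open>d\<close> is a pullback of \<open>d'\<close> along \<open>s\<close>. The mediating
    morphism for \<open>u\<close> and \<open>v\<close> is \<open>u\<close> itself.\<close>
  have "is_pullback C d' s d (idm C (src C d))"
  proof (rule pullbackI)
    fix u v assume uv: "u \<in> mor C" "v \<in> mor C" "src C v = src C u" "tgt C u = src C d'"
      "tgt C v = src C s" "d' \<cdot> u = s \<cdot> v"
    have "d \<cdot> u = t \<cdot> (s \<cdot> v)" using assoc[of u d' t] uv ts m by simp
    also have "\<dots> = v" using cmp_reduce[OF ts(9), of v] uv ts m by simp
    finally show "\<exists>h\<in>mor C. src C h = src C u \<and> tgt C h = src C d \<and> idm C (src C d) \<cdot> h = u \<and> d \<cdot> h = v"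
      using uv m by auto
  qed (use ts m in auto)
  with conflationI(2)[OF E] show ?thesis by (rule deflation_pullback)
qed

text \<open>Two kernels of \<open>d\<close> differ by an isomorphism \<open>t\<close>, and
  \<open>i\<close> is the pushout of \<open>i'\<close> along \<open>t\<close>.\<close>

lemma kernel_inflation:
  assumes "deflation E d" "is_kernel C i d"
  shows "inflation E i"
proof -
  obtain i' where E: "(i', d) \<in> E" using assms(1) by (auto simp: deflation_def)
  note i' = conflationD(1)[OF E]
  obtain t s where ts: "t \<in> mor C" "s \<in> mor C" "src C t = src C i'" "tgt C t = src C i"
    "src C s = src C i" "tgt C s = src C i'" "i \<cdot> t = i'" "i' \<cdot> s = i"
    "t \<cdot> s = idm C (src C i)" "s \<cdot> t = idm C (src C i')"
    using kernel_unique[OF assms(2) i'] by blast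
  note m = kernelD[OF i'] kernelD[OF assms(2)]
  have "is_pushout C i' t i (idm C (tgt C i))"
  proof (rule pushoutI)
    fix u v assume uv: "u \<in> mor C" "v \<in> mor C" "tgt C v = tgt C u" "src C u = tgt C i'"
      "src C v = tgt C t" "u \<cdot> i' = v \<cdot> t"
    have "u \<cdot> i = (v \<cdot> t) \<cdot> s" using assoc[of s i' u] uv ts m by simp
    also have "\<dots> = v" using uv ts m by (simp add: assoc)
    finally show "\<exists>h\<in>mor C. src C h = tgt C i \<and> tgt C h = tgt C u \<and> h \<cdot> idm C (tgt C i) = u \<and> h \<cdot> i = v"
      using uv m by auto
  qed (use ts m in auto)
  with conflationI(1)[OF E] show ?thesis by (rule inflation_pushout)
qed

text \<open>The cokernel \<open>d'\<close> that comes with \<open>i\<close> factors as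
  \<open>s \<cdot> d\<close>, so whatever \<open>d\<close> kills is killed by \<open>d'\<close> and
  lifts along its kernel \<open>i\<close>.\<close>

lemma inflation_cokernel_kernel:
  assumes "inflation E i" "is_cokernel C d i"
  shows "is_kernel C i d"
proof -
  obtain d' where E: "(i, d') \<in> E" using assms(1) by (auto simp: inflation_def)
  note i = conflationD[OF E]
  note m = cokernelD[OF i(2)] cokernelD[OF assms(2)]
  obtain s where s: "s \<in> mor C" "src C s = tgt C d" "tgt C s = tgt C d'" "s \<cdot> d = d'"
    using cokernel_unique[OF assms(2) i(2)] by blast
  show ?thesis
  proof (rule kernelI)
    fix f assume f: "f \<in> mor C" "tgt C f = src C d" "d \<cdot> f = zero_mor C (src C f) (tgt C d)"
    have "d' \<cdot> f = zero_mor C (src C f) (tgt C d')" using assoc[of f d s] s f m by simp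
    then show "\<exists>h\<in>mor C. src C h = src C f \<and> tgt C h = src C i \<and> i \<cdot> h = f"
      using kernel_lift[OF i(1), of f] f m by metis
  qed (use m kernel_mono[OF i(1)] in auto)
qed

section \<open>Identities, morphisms to zero objects and biproduct projections\<close>

lemma inflation_idm:
  assumes "X \<in> obj C"
  shows "inflation E (idm C X)"
proof -
  obtain N where N: "is_zero_object C N" using ex_zero_object by blast
  then have [simp]: "N \<in> obj C" by (simp add: is_zero_object_def)
  obtain i where E: "(i, idm C N) \<in> E" using deflation_idm_zero[OF N] by (auto simp: deflation_def)
  note m = kernelD[OF conflationD(1)[OF E]]
  \<comment> \<open>As \<open>N\<close> is a zero object, every \<open>u\<close> out of
    \<open>N\<close> equals \<open>v\<close> after a zero morphism, so \<open>v\<close> is the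
    mediating morphism.\<close>
  have "is_pushout C i (zero_mor C (src C i) X) (idm C X) (zero_mor C N X)"
  proof (rule pushoutI)
    fix u v assume uv: "u \<in> mor C" "v \<in> mor C" "tgt C v = tgt C u" "src C u = tgt C i"
      "src C v = tgt C (zero_mor C (src C i) X)"
    have "v \<cdot> zero_mor C N X = u"
      by (rule zero_object_unique[OF N]) (use uv m assms in auto)
    then show "\<exists>h\<in>mor C. src C h = tgt C (idm C X) \<and> tgt C h = tgt C u \<and> h \<cdot> zero_mor C N X = u \<and> h \<cdot> idm C X = v"
      using uv m assms by auto
  qed (use m assms in auto)
  with conflationI(1)[OF E] show ?thesis by (rule inflation_pushout)
qed

text \<open>A morphism into a zero object is the cokernel of the identity of its source, which is an
  inflation.\<close>

lemma deflation_to_zero: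
  assumes "is_zero_object C N" "f \<in> mor C" "tgt C f = N"
  shows "deflation E f"
proof (rule cokernel_deflation[OF inflation_idm])
  have f: "f = zero_mor C (src C f) N"
    by (rule zero_object_unique[OF assms(1)]) (use assms in auto)
  show "is_cokernel C f (idm C (src C f))"
  proof (rule cokernelI)
    fix g assume g: "g \<in> mor C" "src C g = tgt C (idm C (src C f))"
      "g \<cdot> idm C (src C f) = zero_mor C (src C (idm C (src C f))) (tgt C g)"
    then have "g = zero_mor C (src C f) (tgt C g)" using assms by simp
    then show "\<exists>h\<in>mor C. src C h = tgt C f \<and> tgt C h = tgt C g \<and> h \<cdot> f = g"
      using g assms by (intro bexI[of _ "zero_mor C N (tgt C g)"]) auto
  qed (use assms f zero_object_unique[OF assms(1)] in auto)
qed (use assms in auto)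

text \<open>For a zero object \<open>N\<close>, the biproduct is the pullback of the morphisms from
  \<open>X\<close> and \<open>Z\<close> to \<open>N\<close>, and the one from \<open>X\<close> is a
  deflation.\<close>

lemma biproduct_deflation:
  assumes b: "is_biproduct C X Z Y i s r d"
  shows "deflation E d"
proof -
  obtain N where N: "is_zero_object C N" using ex_zero_object by blast
  then have [simp]: "N \<in> obj C" by (simp add: is_zero_object_def)
  note m = biproductD[OF b]
  have "is_pullback C (zero_mor C X N) (zero_mor C Z N) d r"
  proof (rule pullbackI)
    fix u v assume uv: "u \<in> mor C" "v \<in> mor C" "src C v = src C u"
      "tgt C u = src C (zero_mor C X N)" "tgt C v = src C (zero_mor C Z N)"
    show "\<exists>h\<in>mor C. src C h = src C u \<and> tgt C h = src C d \<and> r \<cdot> h = u \<and> d \<cdot> h = v"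
      by (rule bexI[of _ "(i \<cdot> u) \<boxplus> (s \<cdot> v)"])
        (use uv m in \<open>auto simp: cmp_plus_mor biproduct_reduce[OF b]\<close>)
  next
    fix g h assume "g \<in> mor C" "h \<in> mor C" "tgt C g = src C d" "tgt C h = src C d"
      "r \<cdot> g = r \<cdot> h" "d \<cdot> g = d \<cdot> h"
    then show "g = h" using biproduct_ext[OF b] m by auto
  qed (use m in auto)
  then show ?thesis
    by (rule deflation_pullback[rotated]) (rule deflation_to_zero[OF N], use m in auto)
qed

section \<open>The obscure axiom for deflations\<close>

text \<open>The morphism \<open>m = (b, x) \<mapsto> (b + e x, d b)\<close> below is the pullback of \<open>d e\<close> along
  \<open>(b, c) \<mapsto> d b - c\<close>.\<close>

lemma deflation_cmp_proj:
  assumes e: "e \<in> mor C" "d \<in> mor C" "tgt C e = src C d" and de: "deflation E (d \<cdot> e)"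
    and b: "is_biproduct C (src C d) (src C e) Y i s r q"
  shows "deflation E (d \<cdot> r)"
proof -
  obtain W i' s' r' q' where b': "is_biproduct C (src C d) (tgt C d) W i' s' r' q'"
    using ex_biproduct e by (meson src_tgt_obj)
  note m = biproductD(1-19)[OF b] biproductD(1-19)[OF b']
  define m where "m = (i' \<cdot> (r \<boxplus> (e \<cdot> q))) \<boxplus> (s' \<cdot> (d \<cdot> r))"
  have mm: "m \<in> mor C" "src C m = Y" "tgt C m = W" using m e by (auto simp: m_def)
  have rm: "r' \<cdot> (m \<cdot> x) = (r \<cdot> x) \<boxplus> (e \<cdot> (q \<cdot> x))" "q' \<cdot> (m \<cdot> x) = d \<cdot> (r \<cdot> x)"
    if "x \<in> mor C" "tgt C x = Y" for x
    using that m e unfolding m_def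
    by (auto simp: cmp_plus_mor plus_cmp_mor assoc biproduct_reduce[OF b'])
  have rm1: "r' \<cdot> m = r \<boxplus> (e \<cdot> q)" "q' \<cdot> m = d \<cdot> r"
    using rm[of "idm C Y"] m mm by auto
  define g where "g = (d \<cdot> r') \<boxplus> neg_mor C q'"
  have gm: "g \<in> mor C" "src C g = W" "tgt C g = tgt C d" using m e by (auto simp: g_def)
  have gx: "g \<cdot> x = (d \<cdot> (r' \<cdot> x)) \<boxplus> neg_mor C (q' \<cdot> x)" if "x \<in> mor C" "tgt C x = W" for x
    using that m e by (auto simp: g_def plus_cmp_mor neg_cmp assoc)
  have "is_pullback C (d \<cdot> e) g m q"
  proof (rule pullbackI)
    \<comment> \<open>On coordinates this says \<open>d (b + e x) - d b = d e x\<close>.\<close>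
    have "g \<cdot> m = ((d \<cdot> r) \<boxplus> (d \<cdot> (e \<cdot> q))) \<boxplus> neg_mor C (d \<cdot> r)"
      using gx[of m] mm rm1 e m by (simp add: cmp_plus_mor)
    also have "\<dots> = ((d \<cdot> (e \<cdot> q)) \<boxplus> (d \<cdot> r)) \<boxplus> neg_mor C (d \<cdot> r)"
      using plus_mor_comm[of "d \<cdot> r" "d \<cdot> (e \<cdot> q)"] e m by simp
    also have "\<dots> = d \<cdot> (e \<cdot> q)"
      using plus_mor_assoc[of "d \<cdot> (e \<cdot> q)" "d \<cdot> r" "neg_mor C (d \<cdot> r)"] e m by simp
    finally show "(d \<cdot> e) \<cdot> q = g \<cdot> m" using e m by (simp add: assoc)
  next
    fix u v assume uv: "u \<in> mor C" "v \<in> mor C" "src C v = src C u" "tgt C u = src C (d \<cdot> e)"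
      "tgt C v = src C g" "(d \<cdot> e) \<cdot> u = g \<cdot> v"
    have uv': "tgt C u = src C e" "tgt C v = W" using uv e gm by auto
    \<comment> \<open>A mediating \<open>h\<close> must have second coordinate \<open>u\<close>;
      comparing first coordinates in \<open>m \<cdot> h = v\<close> then forces its first coordinate
      to be \<open>?a\<close>.\<close>
    let ?a = "(r' \<cdot> v) \<boxplus> neg_mor C (e \<cdot> u)"
    let ?h = "(i \<cdot> ?a) \<boxplus> (s \<cdot> u)"
    have a: "?a \<in> mor C" "src C ?a = src C u" "tgt C ?a = src C d" using uv uv' m e by auto
    have h: "?h \<in> mor C" "src C ?h = src C u" "tgt C ?h = Y" using a uv uv' m e by auto
    have rh: "r \<cdot> ?h = ?a" "q \<cdot> ?h = u"
      using a uv uv' m e by (auto simp: cmp_plus_mor biproduct_reduce[OF b])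
    have 1: "r' \<cdot> (m \<cdot> ?h) = r' \<cdot> v"
      using rm(1)[OF h(1,3)] rh plus_mor_assoc[of "r' \<cdot> v" "neg_mor C (e \<cdot> u)" "e \<cdot> u"] a uv uv' m e
      by simp
    \<comment> \<open>Solved for \<open>d \<cdot> (r' \<cdot> v)\<close>, the compatibility of
      \<open>u\<close> and \<open>v\<close> shows that \<open>?a\<close> also yields the right
      second coordinate of \<open>v\<close>.\<close>
    have X: "(d \<cdot> (r' \<cdot> v)) \<boxplus> neg_mor C (q' \<cdot> v) = d \<cdot> (e \<cdot> u)"
      using gx[of v] uv uv' e by (simp add: assoc)
    have "d \<cdot> (r' \<cdot> v) = (d \<cdot> (e \<cdot> u)) \<boxplus> (q' \<cdot> v)"
      using plus_mor_assoc[of "d \<cdot> (r' \<cdot> v)" "neg_mor C (q' \<cdot> v)" "q' \<cdot> v"] uv uv' m e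
      unfolding X[symmetric] by simp
    also have "\<dots> = (q' \<cdot> v) \<boxplus> (d \<cdot> (e \<cdot> u))"
      by (rule plus_mor_comm) (use uv uv' m e in auto)
    finally have "d \<cdot> ?a = ((q' \<cdot> v) \<boxplus> (d \<cdot> (e \<cdot> u))) \<boxplus> neg_mor C (d \<cdot> (e \<cdot> u))"
      using uv uv' m e by (simp add: cmp_plus_mor cmp_neg)
    also have "\<dots> = q' \<cdot> v"
      using plus_mor_assoc[of "q' \<cdot> v" "d \<cdot> (e \<cdot> u)" "neg_mor C (d \<cdot> (e \<cdot> u))"] uv uv' m e
      by simp
    finally have "d \<cdot> ?a = q' \<cdot> v" .
    then have 2: "q' \<cdot> (m \<cdot> ?h) = q' \<cdot> v"
      using rm(2)[OF h(1,3)] rh by simp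
    have "m \<cdot> ?h = v"
      by (rule biproduct_ext[OF b']) (use 1 2 h mm uv uv' in auto)
    then show "\<exists>h\<in>mor C. src C h = src C u \<and> tgt C h = src C m \<and> q \<cdot> h = u \<and> m \<cdot> h = v"
      using h rh mm by auto
  next
    fix g h assume gh: "g \<in> mor C" "h \<in> mor C" "src C g = src C h" "tgt C g = src C m"
      "tgt C h = src C m" "q \<cdot> g = q \<cdot> h" "m \<cdot> g = m \<cdot> h"
    \<comment> \<open>Equal \<open>q\<close>-coordinates contribute the same term to both sides of
      \<open>m \<cdot> g = m \<cdot> h\<close>; it is moved to the left, where cancellation
      acts.\<close>
    have "(e \<cdot> (q \<cdot> h)) \<boxplus> (r \<cdot> g) = (e \<cdot> (q \<cdot> h)) \<boxplus> (r \<cdot> h)"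
      using rm(1)[of g] rm(1)[of h] gh mm m e plus_mor_comm[of "e \<cdot> (q \<cdot> h)" "r \<cdot> g"]
       plus_mor_comm[of "e \<cdot> (q \<cdot> h)" "r \<cdot> h"] by simp
    then have "r \<cdot> g = r \<cdot> h"
      using plus_mor_cancel[of "e \<cdot> (q \<cdot> h)" "r \<cdot> g" "r \<cdot> h"] gh mm m e by simp
    then show "g = h" using biproduct_ext[OF b, of g h] gh mm by simp
  qed (use m mm gm e in auto)
  then have "deflation E m" using de by (rule deflation_pullback[rotated])
  \<comment> \<open>The second coordinate of \<open>m\<close> is \<open>d \<cdot> r\<close>, and the
    projection \<open>q'\<close> is a deflation.\<close>
  then have "deflation E (q' \<cdot> m)"
    using biproduct_deflation[OF b'] by (rule deflation_cmp) (use mm m in auto)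
  then show ?thesis by (simp add: rm1)
qed

text \<open>Quillen's obscure axiom.\<close>

lemma deflation_cancel:
  assumes e: "e \<in> mor C" "tgt C e = src C d" and de: "deflation E (d \<cdot> e)"
    and k: "is_kernel C k d"
  shows "deflation E d"
proof -
  note km = kernelD[OF k]
  obtain Y i s r q where b: "is_biproduct C (src C d) (src C e) Y i s r q"
    using ex_biproduct e km by (meson src_tgt_obj)
  note m = biproductD(1-19)[OF b]
  \<comment> \<open>\<open>d \<cdot> r\<close> is a deflation by the preceding lemma. The plan is to
    exhibit \<open>k\<close> as a pushout of its kernel \<open>l\<close>, hence as an
    inflation.\<close>
  obtain l where l: "(l, d \<cdot> r) \<in> E"
    using deflation_cmp_proj[OF e(1) km(2) e(2) de b] by (auto simp: deflation_def)
  note lk = conflationD[OF l]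
  have lm: "l \<in> mor C" "tgt C l = Y" "d \<cdot> (r \<cdot> l) = zero_mor C (src C l) (tgt C d)"
    using kernelD[OF lk(1)] m km by (auto simp: assoc)
  \<comment> \<open>\<open>p\<close> is the restriction of \<open>r\<close> to the kernels of
    \<open>d \<cdot> r\<close> and \<open>d\<close>. The lifts \<open>t\<close> and
    \<open>t'\<close> below exist because \<open>r\<close> kills \<open>s\<close> and
    \<open>d\<close> kills \<open>k\<close>.\<close>
  obtain p where p: "p \<in> mor C" "src C p = src C l" "tgt C p = src C k" "k \<cdot> p = r \<cdot> l"
    using kernel_lift[OF k, of "r \<cdot> l"] lm m by auto
  obtain t where t: "t \<in> mor C" "src C t = src C e" "tgt C t = src C l" "l \<cdot> t = s"
    using kernel_lift[OF lk(1), of s] lm m km by (auto simp: assoc)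
  obtain t' where t': "t' \<in> mor C" "src C t' = src C k" "tgt C t' = src C l" "l \<cdot> t' = i \<cdot> k"
    using kernel_lift[OF lk(1), of "i \<cdot> k"] lm m km by (auto simp: assoc biproduct_reduce[OF b])
  \<comment> \<open>After composition with the monomorphism \<open>k\<close>, this and the next
    claim become \<open>r \<cdot> s = 0\<close> and
    \<open>r \<cdot> (i \<cdot> k) = k\<close>.\<close>
  have pt: "p \<cdot> t = zero_mor C (src C e) (src C k)"
    by (rule kernel_mono[OF k])
      (use p t km m lm e cmp_reduce[OF p(4), of t] in \<open>auto simp: assoc\<close>)
  have pt': "p \<cdot> t' = idm C (src C k)"
    by (rule kernel_mono[OF k])
      (use p t' km m lm e cmp_reduce[OF p(4), of t'] in \<open>auto simp: assoc biproduct_reduce[OF b]\<close>)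
  have "is_pushout C l p k r"
  proof (rule pushoutI)
    fix u v assume uv: "u \<in> mor C" "v \<in> mor C" "tgt C v = tgt C u" "src C u = tgt C l"
      "src C v = tgt C p" "u \<cdot> l = v \<cdot> p"
    have uY: "src C u = Y" using uv lm by simp
    \<comment> \<open>\<open>u \<cdot> s = u \<cdot> (l \<cdot> t) = v \<cdot> (p \<cdot> t)\<close>
      vanishes, so \<open>u\<close> factors through the projection \<open>r\<close> as
      \<open>(u \<cdot> i) \<cdot> r\<close>.\<close>
    have us: "u \<cdot> s = zero_mor C (src C e) (tgt C u)"
      using cmp_reduce[OF uv(6), of t] uv uY t p pt lm e by (simp add: assoc)
    have uik: "(u \<cdot> i) \<cdot> k = v"
      using cmp_reduce[OF uv(6), of t'] uv uY t' p pt' lm m km by (simp add: assoc)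
    have "u = u \<cdot> ((i \<cdot> r) \<boxplus> (s \<cdot> q))" using biproductD(20)[OF b] uv uY by simp
    also have "\<dots> = (u \<cdot> (i \<cdot> r)) \<boxplus> ((u \<cdot> s) \<cdot> q)"
      using uv uY m by (simp add: cmp_plus_mor assoc)
    also have "\<dots> = (u \<cdot> i) \<cdot> r" using us uv uY m e by (simp add: assoc)
    finally show "\<exists>h\<in>mor C. src C h = tgt C k \<and> tgt C h = tgt C u \<and> h \<cdot> r = u \<and> h \<cdot> k = v"
      using uik uv uY m km by (intro bexI[of _ "u \<cdot> i"]) auto
  next
    fix g h assume gh: "g \<in> mor C" "h \<in> mor C" "src C g = tgt C k" "src C h = tgt C k" "g \<cdot> r = h \<cdot> r"
    then show "g = h" using biproduct_proj_epi[OF b, of g h] km by simp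
  qed (use p km lm m in auto)
  with conflationI(1)[OF l] have "inflation E k" by (rule inflation_pushout)
  \<comment> \<open>If \<open>g\<close> kills \<open>k\<close>, then \<open>g \<cdot> r\<close>
    kills \<open>l\<close> and factors through \<open>d \<cdot> r\<close>; the split epimorphism
    \<open>r\<close> cancels.\<close>
  moreover have "is_cokernel C d k"
  proof (rule cokernelI)
    fix g assume g: "g \<in> mor C" "src C g = tgt C k" "g \<cdot> k = zero_mor C (src C k) (tgt C g)"
    have "(g \<cdot> r) \<cdot> l = zero_mor C (src C l) (tgt C g)"
      using cmp_reduce[OF g(3), of p] g p km lm m by (simp add: assoc)
    then obtain h where h: "h \<in> mor C" "src C h = tgt C d" "tgt C h = tgt C g" "h \<cdot> (d \<cdot> r) = g \<cdot> r"
      using cokernel_desc[OF lk(2), of "g \<cdot> r"] g lm m km by auto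
    then have "(h \<cdot> d) \<cdot> r = g \<cdot> r" using assoc[of r d h] m km by simp
    then have "h \<cdot> d = g" using biproduct_proj_epi[OF b, of "h \<cdot> d" g] h g km by simp
    then show "\<exists>h\<in>mor C. src C h = tgt C d \<and> tgt C h = tgt C g \<and> h \<cdot> d = g" using h by blast
  next
    fix g h assume gh: "g \<in> mor C" "h \<in> mor C" "tgt C g = tgt C h" "src C g = tgt C d"
      "src C h = tgt C d" "g \<cdot> d = h \<cdot> d"
    show "g = h"
      by (rule cokernel_epi[OF lk(2)]) (use gh m km assoc[of r d g] assoc[of r d h] in auto)
  qed (use km in auto)
  ultimately show ?thesis by (rule cokernel_deflation)
qed

section \<open>Composition of inflations\<close>

text \<open>Keller's argument: let \<open>p\<close> be the cokernel of \<open>i\<close> and \<open>j', p'\<close> the pushout of \<open>j, p\<close>. Then \<open>j i\<close> is a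
  kernel of \<open>p'\<close>. The row \<open>w = (p', j')\<close> is a deflation, being a pullback of the cokernel of \<open>j\<close>;
  since \<open>j' p = p' j\<close>, composing \<open>w\<close> with a pullback of \<open>p\<close> gives a deflation that factors through \<open>p'\<close>.\<close>

lemma inflation_cmp:
  assumes "inflation E i" "inflation E j" "tgt C i = src C j"
  shows "inflation E (j \<cdot> i)"
proof -
  obtain p where p: "(i, p) \<in> E" using assms(1) by (auto simp: inflation_def)
  obtain q where q: "(j, q) \<in> E" using assms(2) by (auto simp: inflation_def)
  note pk = conflationD[OF p] and qk = conflationD[OF q]
  note m = kernelD[OF pk(1)] kernelD[OF qk(1)] assms(3)
  obtain j' p' where po: "is_pushout C j p j' p'"
    using ex_pushout[OF assms(2), of p] m by auto
  have pm: "j' \<in> mor C" "p' \<in> mor C" "src C j' = tgt C p" "src C p' = tgt C j"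
    "tgt C p' = tgt C j'" "p' \<cdot> j = j' \<cdot> p"
    using po by (auto simp: is_pushout_def)
  have j': "inflation E j'" using inflation_pushout[OF assms(2) po] .
  \<comment> \<open>\<open>c\<close> is induced on the pushout by \<open>q\<close> and zero. It
    turns out to be the cokernel of \<open>j'\<close>, with the same target as
    \<open>q\<close>.\<close>
  obtain c where c: "c \<in> mor C" "src C c = tgt C j'" "tgt C c = tgt C q" "c \<cdot> p' = q"
      "c \<cdot> j' = zero_mor C (tgt C p) (tgt C q)"
    using pushout_desc[OF po, of q "zero_mor C (tgt C p) (tgt C q)"] m by auto
  have "is_cokernel C c j'"
  proof (rule cokernelI)
    fix g assume g: "g \<in> mor C" "src C g = tgt C j'" "g \<cdot> j' = zero_mor C (src C j') (tgt C g)"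
    \<comment> \<open>By the pushout square, a morphism \<open>g\<close> killing \<open>j'\<close>
      gives a \<open>g \<cdot> p'\<close> killing \<open>j\<close>, which descends along
      \<open>q\<close>.\<close>
    have "(g \<cdot> p') \<cdot> j = zero_mor C (src C j) (tgt C g)"
      using cmp_reduce[OF g(3), of p] g pm m by (simp add: assoc)
    then obtain h where h: "h \<in> mor C" "src C h = tgt C q" "tgt C h = tgt C g" "h \<cdot> q = g \<cdot> p'"
      using cokernel_desc[OF qk(2), of "g \<cdot> p'"] g pm m by auto
    have "h \<cdot> c = g"
      by (rule pushout_ext[OF po]) (use h g c pm m in \<open>auto simp: assoc\<close>)
    then show "\<exists>h\<in>mor C. src C h = tgt C c \<and> tgt C h = tgt C g \<and> h \<cdot> c = g" using h c by auto
  next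
    fix g h assume gh: "g \<in> mor C" "h \<in> mor C" "tgt C g = tgt C h" "src C g = tgt C c"
      "src C h = tgt C c" "g \<cdot> c = h \<cdot> c"
    have "g \<cdot> q = h \<cdot> q" using gh c pm assoc[of p' c g] assoc[of p' c h] by simp
    then show "g = h" using cokernel_epi[OF qk(2), of g h] gh c by simp
  qed (use c pm in auto)
  then have cj': "is_kernel C j' c" using inflation_cokernel_kernel[OF j'] by simp
  obtain Y i1 s1 r1 d1 where b: "is_biproduct C (tgt C j) (tgt C p) Y i1 s1 r1 d1"
    using ex_biproduct m by (meson src_tgt_obj)
  note bm = biproductD(1-19)[OF b]
  define w where "w = (p' \<cdot> r1) \<boxplus> (j' \<cdot> d1)"
  have wm: "w \<in> mor C" "src C w = Y" "tgt C w = tgt C j'" using bm pm m by (auto simp: w_def)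
  have wx: "w \<cdot> x = (p' \<cdot> (r1 \<cdot> x)) \<boxplus> (j' \<cdot> (d1 \<cdot> x))" if "x \<in> mor C" "tgt C x = Y" for x
    using that bm pm m by (auto simp: w_def plus_cmp_mor assoc)
  have "is_pullback C q c w r1"
  proof (rule pullbackI)
    show "q \<cdot> r1 = c \<cdot> w"
      using bm pm m c cmp_reduce[OF c(4), of r1] cmp_reduce[OF c(5), of d1]
      by (simp add: w_def cmp_plus_mor)
  next
    fix u v assume uv: "u \<in> mor C" "v \<in> mor C" "src C v = src C u" "tgt C u = src C q"
      "tgt C v = src C c" "q \<cdot> u = c \<cdot> v"
    \<comment> \<open>The difference of \<open>v\<close> and \<open>p' \<cdot> u\<close> lies in the
      kernel \<open>j'\<close> of \<open>c\<close>; its lift \<open>t\<close> is the second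
      coordinate of the mediating morphism, with \<open>u\<close> as the first.\<close>
    have "c \<cdot> (neg_mor C (p' \<cdot> u) \<boxplus> v) = zero_mor C (src C u) (tgt C c)"
      using uv c pm m cmp_reduce[OF c(4), of u] by (simp add: cmp_plus_mor cmp_neg)
    then obtain t where t: "t \<in> mor C" "src C t = src C u" "tgt C t = src C j'"
        "j' \<cdot> t = neg_mor C (p' \<cdot> u) \<boxplus> v"
      using kernel_lift[OF cj', of "neg_mor C (p' \<cdot> u) \<boxplus> v"] uv c pm m by auto
    have "w \<cdot> ((i1 \<cdot> u) \<boxplus> (s1 \<cdot> t)) = v"
      using wx[of "(i1 \<cdot> u) \<boxplus> (s1 \<cdot> t)"] uv t bm pm m c plus_neg_cancel[of "p' \<cdot> u" v]
      by (simp add: cmp_plus_mor biproduct_reduce[OF b])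
    moreover have "r1 \<cdot> ((i1 \<cdot> u) \<boxplus> (s1 \<cdot> t)) = u"
      using uv t bm pm m by (simp add: cmp_plus_mor biproduct_reduce[OF b])
    ultimately show "\<exists>h\<in>mor C. src C h = src C u \<and> tgt C h = src C w \<and> r1 \<cdot> h = u \<and> w \<cdot> h = v"
      using uv t bm pm m wm by (intro bexI[of _ "(i1 \<cdot> u) \<boxplus> (s1 \<cdot> t)"]) auto
  next
    fix g h assume gh: "g \<in> mor C" "h \<in> mor C" "src C g = src C h" "tgt C g = src C w"
      "tgt C h = src C w" "r1 \<cdot> g = r1 \<cdot> h" "w \<cdot> g = w \<cdot> h"
    have "j' \<cdot> (d1 \<cdot> g) = j' \<cdot> (d1 \<cdot> h)"
      using wx[of g] wx[of h] gh wm bm pm m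
        plus_mor_cancel[of "p' \<cdot> (r1 \<cdot> h)" "j' \<cdot> (d1 \<cdot> g)" "j' \<cdot> (d1 \<cdot> h)"] by simp
    then have "d1 \<cdot> g = d1 \<cdot> h"
      using kernel_mono[OF cj', of "d1 \<cdot> g" "d1 \<cdot> h"] gh wm bm pm by simp
    then show "g = h" using biproduct_ext[OF b] gh wm by simp
  qed (use wm c bm pm m in auto)
  with conflationI(2)[OF q] have w: "deflation E w" by (rule deflation_pullback)
  obtain p1 f1 where pb: "is_pullback C p d1 p1 f1"
    using ex_pullback[OF conflationI(2)[OF p], of d1] bm by auto
  with conflationI(2)[OF p] have "deflation E p1" by (rule deflation_pullback)
  have p1: "p1 \<in> mor C" "f1 \<in> mor C" "tgt C p1 = Y" "tgt C f1 = src C p" "src C p1 = src C f1"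
      "p \<cdot> f1 = d1 \<cdot> p1"
    using pb bm by (auto simp: is_pullback_def)
  \<comment> \<open>The square \<open>d1 \<cdot> p1 = p \<cdot> f1\<close> and then
    \<open>j' \<cdot> p = p' \<cdot> j\<close> turn the second summand into a composite with
    \<open>p'\<close>.\<close>
  have "w \<cdot> p1 = (p' \<cdot> (r1 \<cdot> p1)) \<boxplus> ((p' \<cdot> j) \<cdot> f1)"
    using wx[of p1] p1 bm pm m by (simp add: assoc)
  also have "\<dots> = p' \<cdot> ((r1 \<cdot> p1) \<boxplus> (j \<cdot> f1))"
    using p1 bm pm(1-5) m by (simp add: cmp_plus_mor assoc)
  finally have p'd: "deflation E (p' \<cdot> ((r1 \<cdot> p1) \<boxplus> (j \<cdot> f1)))"
    using deflation_cmp[OF \<open>deflation E p1\<close> w] p1 wm by simp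
  have ker: "is_kernel C (j \<cdot> i) p'"
  proof (rule kernelI)
    show "p' \<cdot> (j \<cdot> i) = zero_mor C (src C (j \<cdot> i)) (tgt C p')"
      using cmp_reduce[OF pm(6), of i] pm(1-5) m by (simp add: assoc)
  next
    fix f assume f: "f \<in> mor C" "tgt C f = src C p'" "p' \<cdot> f = zero_mor C (src C f) (tgt C p')"
    \<comment> \<open>Since \<open>q = c \<cdot> p'\<close>, \<open>f\<close> lifts along
      \<open>j\<close> to some \<open>g\<close>. Then
      \<open>j' \<cdot> (p \<cdot> g) = p' \<cdot> f = 0\<close> with \<open>j'\<close> a
      monomorphism, so \<open>g\<close> lifts along \<open>i\<close>.\<close>
    have "q \<cdot> f = zero_mor C (src C f) (tgt C q)"
      using assoc[of f p' c] f c pm by simp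
    then obtain g where g: "g \<in> mor C" "src C g = src C f" "tgt C g = src C j" "j \<cdot> g = f"
      using kernel_lift[OF qk(1) f(1)] f(2) pm(4) m(7) by metis
    have jpg: "j' \<cdot> (p \<cdot> g) = j' \<cdot> zero_mor C (src C f) (tgt C p)"
      using cmp_reduce[OF pm(6), of g] f g pm(1-5) m by (simp add: assoc)
    have "p \<cdot> g = zero_mor C (src C f) (tgt C p)"
      by (rule kernel_mono[OF cj' _ _ _ _ _ jpg]) (use f(1) g(1-3) pm(1-5) m in auto)
    then obtain h where h: "h \<in> mor C" "src C h = src C f" "tgt C h = src C i" "i \<cdot> h = g"
      using kernel_lift[OF pk(1), of g] g(1-3) m by metis
    have "(j \<cdot> i) \<cdot> h = f" using h g m by (simp add: assoc)
    then show "\<exists>h\<in>mor C. src C h = src C f \<and> tgt C h = src C (j \<cdot> i) \<and> (j \<cdot> i) \<cdot> h = f"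
      using h(1-3) m by auto
  next
    fix g h assume gh: "g \<in> mor C" "h \<in> mor C" "src C g = src C h" "tgt C g = src C (j \<cdot> i)"
      "tgt C h = src C (j \<cdot> i)" "(j \<cdot> i) \<cdot> g = (j \<cdot> i) \<cdot> h"
    have gh': "tgt C g = src C i" "tgt C h = src C i" using gh m by auto
    have "(j \<cdot> i) \<cdot> g = j \<cdot> (i \<cdot> g)" "(j \<cdot> i) \<cdot> h = j \<cdot> (i \<cdot> h)"
      using gh(1,2) gh' m by (simp_all add: assoc)
    then have jig: "j \<cdot> (i \<cdot> g) = j \<cdot> (i \<cdot> h)" using gh(6) by metis
    have ig: "i \<cdot> g = i \<cdot> h"
      by (rule kernel_mono[OF qk(1) _ _ _ _ _ jig]) (use gh(1-3) gh' m in auto)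
    show "g = h"
      by (rule kernel_mono[OF pk(1) _ _ _ _ _ ig]) (use gh(1-3) gh' in auto)
  qed (use pm m in auto)
  have "deflation E p'"
    by (rule deflation_cancel[OF _ _ p'd ker]) (use p1 bm pm m in auto)
  then show ?thesis using ker by (rule kernel_inflation)
qed

end

section \<open>The opposite category\<close>

text \<open>Morphisms stay the same elements with source and target exchanged, so every notion for
  \<open>opcat C\<close> rewrites to its dual in \<open>C\<close>.\<close>

definition opcat :: "('o, 'm, 'x) addcat_scheme \<Rightarrow> ('o, 'm) addcat" where
  "opcat C = \<lparr>obj = obj C, mor = mor C, src = tgt C, tgt = src C, cmp = (\<lambda>g f. f \<cdot>\<^bsub>C\<^esub> g),
     idm = idm C, plus_mor = plus_mor C, zero_mor = (\<lambda>X Y. zero_mor C Y X)\<rparr>"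

lemma opcat_simps [simp]:
  "obj (opcat C) = obj C" "mor (opcat C) = mor C" "src (opcat C) = tgt C" "tgt (opcat C) = src C"
  "g \<cdot>\<^bsub>opcat C\<^esub> f = f \<cdot>\<^bsub>C\<^esub> g" "idm (opcat C) = idm C" "plus_mor (opcat C) = plus_mor C"
  "zero_mor (opcat C) X Y = zero_mor C Y X"
  by (simp_all add: opcat_def)

lemma Hom_opcat [simp]: "Hom (opcat C) X Y = Hom C Y X"
  by (auto simp: Hom_def)

lemma Hom_group_opcat [simp]: "Hom_group (opcat C) X Y = Hom_group C Y X"
  by (simp add: Hom_group_def)

lemma is_zero_object_opcat [simp]: "is_zero_object (opcat C) N \<longleftrightarrow> is_zero_object C N"
  unfolding is_zero_object_def opcat_simps Hom_opcat by blast

lemma is_biproduct_opcat [simp]: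
  "is_biproduct (opcat C) X Z Y i s r d \<longleftrightarrow> is_biproduct C X Z Y r d i s"
  unfolding is_biproduct_def opcat_simps Hom_opcat
  by (intro iffI; elim conjE; intro conjI; assumption)

lemma is_kernel_opcat [simp]: "is_kernel (opcat C) i d \<longleftrightarrow> is_cokernel C i d"
  unfolding is_kernel_def is_cokernel_def opcat_simps Hom_opcat
  by (intro iffI; elim conjE; intro conjI; (assumption | rule sym, assumption))

lemma is_cokernel_opcat [simp]: "is_cokernel (opcat C) d i \<longleftrightarrow> is_kernel C d i"
  unfolding is_kernel_def is_cokernel_def opcat_simps Hom_opcat
  by (intro iffI; elim conjE; intro conjI; (assumption | rule sym, assumption))

lemma is_pullback_opcat [simp]: "is_pullback (opcat C) = is_pushout C"
  by (intro ext) (unfold is_pullback_def is_pushout_def opcat_simps Hom_opcat, rule refl)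

lemma is_pushout_opcat [simp]: "is_pushout (opcat C) = is_pullback C"
  by (intro ext) (unfold is_pullback_def is_pushout_def opcat_simps Hom_opcat, rule refl)

text \<open>Kernels and cokernels change places in the opposite category, so its conflations are the
  pairs of the converse relation.\<close>

lemma inflation_converse [simp]: "inflation (E\<inverse>) i \<longleftrightarrow> deflation E i"
  by (auto simp: inflation_def deflation_def)

lemma deflation_converse [simp]: "deflation (E\<inverse>) i \<longleftrightarrow> inflation E i"
  by (auto simp: inflation_def deflation_def)

section \<open>Duality for additive and exact categories\<close>

lemma (in additive_category) additive_category_opcat: "additive_category (opcat C)"
proof (intro additive_category.intro category.intro additive_category_axioms.intro;
    unfold opcat_simps Hom_opcat Hom_group_opcat is_zero_object_opcat is_biproduct_opcat)
  fix f g h X Y Z W assume "f \<in> Hom C Y X" "g \<in> Hom C Z Y" "h \<in> Hom C W Z"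
  then show "f \<cdot> (g \<cdot> h) = (f \<cdot> g) \<cdot> h" using cmp_assoc[of h W Z g Y f X] by simp
next
  fix X Z assume "X \<in> obj C" "Z \<in> obj C"
  then show "\<exists>Y i s r d. is_biproduct C X Z Y r d i s" using ex_biproduct[of X Z] by blast
next
  fix f f' g X Y Z assume "f \<in> Hom C Y X" "f' \<in> Hom C Y X" "g \<in> Hom C Z Y"
  then show "(f \<boxplus> f') \<cdot> g = (f \<cdot> g) \<boxplus> (f' \<cdot> g)" by (intro plus_cmp)
next
  fix f g g' X Y Z assume "f \<in> Hom C Y X" "g \<in> Hom C Z Y" "g' \<in> Hom C Z Y"
  then show "f \<cdot> (g \<boxplus> g') = (f \<cdot> g) \<boxplus> (f \<cdot> g')" by (intro cmp_plus)
qed ((rule src_obj tgt_obj idm_Hom cmp_Hom cmp_idm idm_cmp Hom_comm_group; assumption)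
  | rule ex_zero_object)+

text \<open>The pullback and pushout axioms are dual to each other. The remaining two dualise to
  \<open>inflation_idm\<close> and \<open>inflation_cmp\<close>.\<close>

lemma (in exact_category) exact_category_opcat: "exact_category (opcat C) (E\<inverse>)"
proof -
  interpret op: additive_category "opcat C" by (rule additive_category_opcat)
  show ?thesis
  proof
    show "exact_structure (opcat C) (E\<inverse>)"
      unfolding exact_structure_def
    proof (intro conjI allI impI ballI)
      fix p assume "p \<in> E\<inverse>"
      then show "case p of (i, d) \<Rightarrow> kernel_cokernel_pair (opcat C) i d"
        using conflationD by (cases p) (auto simp: kernel_cokernel_pair_def)
    next
      fix N assume "is_zero_object (opcat C) N"
      then show "deflation (E\<inverse>) (idm (opcat C) N)"
        using inflation_idm[of N] by (simp add: is_zero_object_def)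
    next
      fix d e assume "deflation (E\<inverse>) d \<and> deflation (E\<inverse>) e \<and> tgt (opcat C) d = src (opcat C) e"
      then show "deflation (E\<inverse>) (e \<cdot>\<^bsub>opcat C\<^esub> d)"
        using inflation_cmp[of e d] by simp
    qed (auto intro: ex_pullback ex_pushout deflation_pullback inflation_pushout)
  qed
qed

text \<open>Dualising exchanges the two summands. The two definitions name the middle object
  differently, as \<open>tgt C i\<close> and \<open>src C d\<close>; a biproduct makes these
  equal.\<close>

lemma (in additive_category) splits_opcat [simp]: "splits (opcat C) d i \<longleftrightarrow> splits C i d"
proof
  assume "splits (opcat C) d i"
  then obtain s r where b: "is_biproduct C (tgt C d) (src C i) (tgt C i) r i d s"
    by (auto simp: splits_def)
  have "src C d = tgt C i" using biproductD(11)[OF b] .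
  then show "splits C i d" using biproduct_swap[OF b] unfolding splits_def by metis
next
  assume "splits C i d"
  then obtain s r where b: "is_biproduct C (src C i) (tgt C d) (src C d) i s r d"
    by (auto simp: splits_def)
  have "tgt C i = src C d" using biproductD(6)[OF b] .
  then show "splits (opcat C) d i" using biproduct_swap[OF b] unfolding splits_def by auto
qed

section \<open>Flat and projective objects\<close>

context additive_category
begin

text \<open>As \<open>k\<close> is a kernel, covariant Hom is left exact: lifts are unique and exist
  for whatever \<open>e\<close> kills. Only surjectivity at the end remains.\<close>

lemma Hom_from_exact_iff:
  assumes "M \<in> obj C" and k: "is_kernel C k e"
  shows "Hom_from_exact C M k e \<longleftrightarrow>
    (\<forall>f\<in>Hom C M (tgt C e). \<exists>g\<in>Hom C M (src C e). e \<cdot> g = f)"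
proof -
  note m = kernelD[OF k]
  let ?A = "Hom_group C M (src C k)" and ?B = "Hom_group C M (src C e)"
    and ?K = "Hom_group C M (tgt C e)"
  have grp: "group ?A" "group ?B" "group ?K"
    using m assms(1) by (auto intro!: comm_group.axioms(2) Hom_comm_group)
  have hom: "(\<lambda>h. k \<cdot> h) \<in> hom ?A ?B" "(\<lambda>h. e \<cdot> h) \<in> hom ?B ?K"
    unfolding hom_def Hom_group_def using m
    by (intro CollectI conjI ballI funcsetI; simp add: Hom_iff cmp_plus_mor)+
  have zero: "group_hom (singleton_group \<one>\<^bsub>?A\<^esub>) ?A (\<lambda>_. \<one>\<^bsub>?A\<^esub>)"
  proof -
    interpret A: group ?A by (rule grp(1))
    show ?thesis using grp(1) by (simp add: group_hom_def group_hom_axioms_def hom_def)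
  qed
  have inj: "kernel ?A ?B ((\<cdot>) k) = {\<one>\<^bsub>?A\<^esub>}"
  proof -
    have "x = zero_mor C M (src C k)"
      if "x \<in> mor C" "src C x = M" "tgt C x = src C k" "k \<cdot> x = zero_mor C M (src C e)" for x
      using kernel_mono[OF k, of x "zero_mor C M (src C k)"] that m assms(1) by simp
    moreover have "k \<cdot> zero_mor C M (src C k) = zero_mor C M (src C e)"
      using m assms(1) by simp
    moreover have "zero_mor C M (src C k) \<in> Hom C M (src C k)"
      using m assms(1) by (simp add: Hom_iff)
    ultimately have "{x \<in> Hom C M (src C k). k \<cdot> x = zero_mor C M (src C e)} = {zero_mor C M (src C k)}"
      unfolding Hom_iff by blast
    then show ?thesis by (simp add: kernel_def Hom_group_def)
  qed
  have ex: "kernel ?B ?K ((\<cdot>) e) = (\<cdot>) k ` carrier ?A"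
  proof -
    have "f \<in> (\<cdot>) k ` Hom C M (src C k)"
      if asm: "f \<in> Hom C M (src C e)" "e \<cdot> f = zero_mor C M (tgt C e)" for f
    proof -
      have f: "f \<in> mor C" "src C f = M" "tgt C f = src C e" using asm(1) by (simp_all add: Hom_iff)
      obtain h where "h \<in> mor C" "src C h = M" "tgt C h = src C k" "k \<cdot> h = f"
        using kernel_lift[OF k f(1,3)] asm(2) unfolding f(2) by metis
      then show ?thesis using Hom_iff by (metis image_eqI)
    qed
    moreover have "k \<cdot> g \<in> Hom C M (src C e)" "e \<cdot> (k \<cdot> g) = zero_mor C M (tgt C e)"
      if "g \<in> Hom C M (src C k)" for g
      using that cmp_reduce[OF m(4), of g] m by (simp_all add: Hom_iff)
    ultimately have "{f \<in> Hom C M (src C e). e \<cdot> f = zero_mor C M (tgt C e)} = (\<cdot>) k ` Hom C M (src C k)"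
      by blast
    then show ?thesis by (simp add: kernel_def Hom_group_def)
  qed
  \<comment> \<open>The last map goes to a trivial group, so exactness there means that composition
    with \<open>e\<close> is onto.\<close>
  have ker: "kernel ?K (singleton_group \<one>\<^bsub>?K\<^esub>) (\<lambda>_. \<one>\<^bsub>?K\<^esub>) = Hom C M (tgt C e)"
    by (auto simp: kernel_def singleton_group_def Hom_group_def)
  have im: "(\<cdot>) e ` carrier ?B \<subseteq> Hom C M (tgt C e)"
    using m by (auto simp: Hom_group_def Hom_iff)
  have "Hom_from_exact C M k e \<longleftrightarrow> Hom C M (tgt C e) = (\<cdot>) e ` carrier ?B"
    using grp hom zero by (simp add: Hom_from_exact_def short_exact_def inj ex ker)
  also have "\<dots> \<longleftrightarrow> (\<forall>f\<in>Hom C M (tgt C e). \<exists>g\<in>Hom C M (src C e). e \<cdot> g = f)"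
    using im by (auto simp: Hom_group_def)
  finally show ?thesis .
qed

end

text \<open>The pullback \<open>e'\<close> of \<open>e\<close> along \<open>h\<close> is a deflation
  onto \<open>P\<close> and splits; a section of it followed by \<open>h'\<close> is the
  lift.\<close>

lemma (in exact_category) projective_lift:
  assumes "projective_object C E P" "deflation E e" "h \<in> mor C" "src C h = P" "tgt C h = tgt C e"
  obtains u where "u \<in> mor C" "src C u = P" "tgt C u = src C e" "e \<cdot> u = h"
proof -
  obtain e' h' where pb: "is_pullback C e h e' h'"
    using ex_pullback[OF assms(2,3,5)] by blast
  have m: "e \<in> mor C" "e' \<in> mor C" "h' \<in> mor C" "tgt C e' = P" "tgt C h' = src C e"
    "src C e' = src C h'" "e \<cdot> h' = h \<cdot> e'"
    using pb assms(4) by (auto simp: is_pullback_def)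
  obtain k where "(k, e') \<in> E"
    using deflation_pullback[OF assms(2) pb] by (auto simp: deflation_def)
  then have "splits C k e'" using assms(1) m(4) by (auto simp: projective_object_def)
  then obtain s r where "is_biproduct C (src C k) P (src C e') k s r e'"
    using m(4) by (auto simp: splits_def)
  note s = biproductD(7-9,17)[OF this]
  have "e \<cdot> (h' \<cdot> s) = h"
    using cmp_reduce[OF m(7), of s] s m(1-6) assms(3-5) by (simp add: assoc)
  then show ?thesis using that[of "h' \<cdot> s"] s m by simp
qed

lemma factors_throughI:
  assumes "category C" "g \<in> Hom C X W" "h \<in> Hom C W Y"
  shows "factors_through C (h \<cdot>\<^bsub>C\<^esub> g) W"
proof -
  have "src C (h \<cdot>\<^bsub>C\<^esub> g) = X" "tgt C (h \<cdot>\<^bsub>C\<^esub> g) = Y"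
    using category.cmp_Hom[OF assms] by (simp_all add: Hom_iff)
  then show ?thesis using assms(2,3) unfolding factors_through_def by blast
qed

section \<open>Two exact structures on one category\<close>

locale exact_category_pair = exact_category C E + D: exact_category C D
  for C :: "('o, 'm, 'x) addcat_scheme" (structure) and D E
begin

lemma projective_imp_flat:
  assumes "projective_object C D P"
  shows "flat_object C D E P"
  unfolding flat_object_def
proof (intro conjI allI impI)
  fix d assume d: "deflation D d \<and> tgt C d = P"
  then obtain i where "(i, d) \<in> D" by (auto simp: deflation_def)
  then have "splits C i d" using assms d by (auto simp: projective_object_def)
  then show "deflation E d" using biproduct_deflation by (auto simp: splits_def)
qed (use assms in \<open>simp add: projective_object_def\<close>)

text \<open>The pullback \<open>e'\<close> of \<open>e\<close> along \<open>d\<close> ends in a flat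
  object, so \<open>e \<cdot> f = d \<cdot> e'\<close> is an \<open>E\<close>-deflation. As
  \<open>e\<close> has a kernel from \<open>D\<close>, the obscure axiom removes
  \<open>f\<close>.\<close>

lemma flat_if_conflation_flat:
  assumes "(i, d) \<in> E" "tgt C d = Z" "flat_object C D E (src C d)"
  shows "flat_object C D E Z"
  unfolding flat_object_def
proof (intro conjI allI impI)
  have dm: "d \<in> mor C" using kernelD(2)[OF conflationD(1)[OF assms(1)]] .
  then show "Z \<in> obj C" using assms(2) by auto
  fix e assume e: "deflation D e \<and> tgt C e = Z"
  then obtain k where k: "(k, e) \<in> D" by (auto simp: deflation_def)
  obtain e' f where pb: "is_pullback C e d e' f"
    using D.ex_pullback[of e d] e dm assms(2) by auto
  have m: "e \<in> mor C" "e' \<in> mor C" "f \<in> mor C" "tgt C e' = src C d" "tgt C f = src C e"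
    "e \<cdot> f = d \<cdot> e'"
    using pb by (auto simp: is_pullback_def)
  have "deflation D e'" using D.deflation_pullback[OF _ pb] e by simp
  then have "deflation E e'" using assms(3) m(4) by (auto simp: flat_object_def)
  then have "deflation E (e \<cdot> f)"
    unfolding m(6) using conflationI(2)[OF assms(1)] m(4) by (rule deflation_cmp)
  then show "deflation E e"
    by (rule deflation_cancel[OF m(3,5) _ D.conflationD(1)[OF k]])
qed

section \<open>Characterisations of flat objects with enough projectives\<close>

context
  assumes enough: "enough_projectives C D"
begin

lemma flat_imp_conflation_projective:
  assumes "flat_object C D E Z"
  shows "\<exists>(i, d)\<in>E. tgt C d = Z \<and> projective_object C D (src C d)"
proof -
  obtain i d where d: "(i, d) \<in> D" "tgt C d = Z" "projective_object C D (src C d)"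
    using enough assms unfolding enough_projectives_def flat_object_def by blast
  then have "deflation E d"
    using assms D.conflationI(2) by (auto simp: flat_object_def)
  \<comment> \<open>The \<open>E\<close>-conflation obtained has deflation \<open>d\<close>, but its
    inflation need not be the \<open>i\<close> chosen in \<open>D\<close>.\<close>
  then show ?thesis using d by (auto simp: deflation_def)
qed

text \<open>The implications run in a cycle: flatness gives a projective middle term, projective
  objects are flat, and a flat middle term gives flatness back.\<close>

lemma flat_iff_conflation_projective:
  "flat_object C D E Z \<longleftrightarrow> (\<exists>(i, d)\<in>E. tgt C d = Z \<and> projective_object C D (src C d))"
  using flat_imp_conflation_projective flat_if_conflation_flat projective_imp_flat by blast

lemma flat_iff_conflation_flat:
  "flat_object C D E Z \<longleftrightarrow> (\<exists>(i, d)\<in>E. tgt C d = Z \<and> flat_object C D E (src C d))"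
  using flat_imp_conflation_projective flat_if_conflation_flat projective_imp_flat by blast

text \<open>Forwards, \<open>f\<close> lifts through the projective middle term of an
  \<open>E\<close>-conflation ending in \<open>Z\<close>. Backwards, a factorisation
  \<open>f = h \<cdot> g\<close> through \<open>P\<close> gives a lift of \<open>f\<close> along any
  \<open>D\<close>-deflation onto \<open>Z\<close>, since \<open>h\<close> lifts; hence Hom from
  \<open>M\<close> stays exact.\<close>

lemma flat_iff_factors_through_projective:
  assumes gen: "projectively_generated C D E \<M>" and Z: "Z \<in> obj C"
  shows "flat_object C D E Z \<longleftrightarrow>
    (\<forall>M\<in>\<M>. \<forall>f\<in>Hom C M Z. \<exists>P. projective_object C D P \<and> factors_through C f P)"
proof (intro iffI ballI)
  fix M f assume flat: "flat_object C D E Z" and M: "M \<in> \<M>" and f: "f \<in> Hom C M Z"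
  obtain i d where d: "(i, d) \<in> E" "tgt C d = Z" "projective_object C D (src C d)"
    using flat_imp_conflation_projective[OF flat] by blast
  have "M \<in> obj C" using gen M by (auto simp: projectively_generated_def)
  moreover have "Hom_from_exact C M i d" using gen M d(1) by (auto simp: projectively_generated_def)
  ultimately obtain g where g: "g \<in> Hom C M (src C d)" "d \<cdot> g = f"
    using Hom_from_exact_iff[OF _ conflationD(1)[OF d(1)]] f d(2) by blast
  have "d \<in> Hom C (src C d) Z"
    using kernelD(2)[OF conflationD(1)[OF d(1)]] d(2) by (simp add: Hom_iff)
  from factors_throughI[OF category_axioms g(1) this]
  show "\<exists>P. projective_object C D P \<and> factors_through C f P" using d(3) g(2) by auto
next
  assume fac: "\<forall>M\<in>\<M>. \<forall>f\<in>Hom C M Z. \<exists>P. projective_object C D P \<and> factors_through C f P"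
  show "flat_object C D E Z"
    unfolding flat_object_def
  proof (intro conjI allI impI)
    fix e assume "deflation D e \<and> tgt C e = Z"
    then obtain k where e: "(k, e) \<in> D" "tgt C e = Z" by (auto simp: deflation_def)
    note ker = D.conflationD(1)[OF e(1)]
    have em: "e \<in> mor C" by (rule kernelD(2)[OF ker])
    have "Hom_from_exact C M k e" if M: "M \<in> \<M>" for M
    proof -
      have "\<exists>g\<in>Hom C M (src C e). e \<cdot> g = f" if f: "f \<in> Hom C M Z" for f
      proof -
        have "src C f = M" "tgt C f = Z" using f by (simp_all add: Hom_iff)
        then obtain P g h
          where P: "projective_object C D P" "f = h \<cdot> g" "g \<in> Hom C M P" "h \<in> Hom C P Z"
          using fac M f unfolding factors_through_def by blast
        then obtain u where u: "u \<in> mor C" "src C u = P" "tgt C u = src C e" "e \<cdot> u = h"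
          using D.projective_lift[OF P(1) D.conflationI(2)[OF e(1)], of h] e(2)
          by (auto simp: Hom_iff)
        then have "e \<cdot> (u \<cdot> g) = f" "u \<cdot> g \<in> Hom C M (src C e)"
          using P(2,3) cmp_reduce[OF u(4), of g] em by (simp_all add: Hom_iff)
        then show ?thesis by blast
      qed
      moreover have "M \<in> obj C" using gen M by (auto simp: projectively_generated_def)
      ultimately show ?thesis using Hom_from_exact_iff[OF _ ker] e(2) by simp
    qed
    then have "(k, e) \<in> E" using gen e(1) by (auto simp: projectively_generated_def)
    then show "deflation E e" by (rule conflationI)
  qed (rule Z)
qed

end

end

section \<open>Dualisation\<close>

lemma flat_object_opcat [simp]:
  "flat_object (opcat C) (D\<inverse>) (E\<inverse>) X \<longleftrightarrow> divisible_object C D E X"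
  by (simp add: flat_object_def divisible_object_def)

lemma (in additive_category) projective_object_opcat [simp]:
  "projective_object (opcat C) (D\<inverse>) X \<longleftrightarrow> injective_object C D X"
  by (auto simp: projective_object_def injective_object_def)

lemma (in additive_category) enough_projectives_opcat [simp]:
  "enough_projectives (opcat C) (D\<inverse>) \<longleftrightarrow> enough_injectives C D"
  by (auto simp: enough_projectives_def enough_injectives_def)

text \<open>Both definitions take \<open>src\<close> of the deflation as middle object, which in the
  opposite category reads \<open>tgt C i\<close>; the premise identifies the two.\<close>

lemma Hom_from_exact_opcat:
  "tgt C i = src C d \<Longrightarrow> Hom_from_exact (opcat C) M d i \<longleftrightarrow> Hom_into_exact C M i d"
  by (simp add: Hom_from_exact_def Hom_into_exact_def)

text \<open>Pairs in \<open>E\<close> are composable because their first component is a kernel of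
  the second, so the two Hom conditions agree on them.\<close>

lemma (in exact_category) projectively_generated_opcat [simp]:
  "projectively_generated (opcat C) (E\<inverse>) (E'\<inverse>) \<M> \<longleftrightarrow> injectively_generated C E E' \<M>"
proof -
  have "{(d, i). (d, i) \<in> E\<inverse> \<and> (\<forall>M\<in>\<M>. Hom_from_exact (opcat C) M d i)} =
      {(i, d). (i, d) \<in> E \<and> (\<forall>M\<in>\<M>. Hom_into_exact C M i d)}\<inverse>"
    using Hom_from_exact_opcat kernelD(3)[OF conflationD(1)] by fastforce
  then show ?thesis
    unfolding projectively_generated_def injectively_generated_def by simp
qed

lemma factors_through_opcat [simp]: "factors_through (opcat C) f W \<longleftrightarrow> factors_through C f W"
  by (auto simp: factors_through_def)

lemma (in exact_category_pair) exact_category_pair_opcat: "exact_category_pair (opcat C) (D\<inverse>) (E\<inverse>)"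
  by (intro exact_category_pair.intro exact_category_opcat D.exact_category_opcat)

section \<open>Both halves, from the category and from its opposite\<close>

theorem proposition4p6:
  fixes C :: "('o, 'm, 'x) addcat_scheme"
    and D E :: "('m \<times> 'm) set"
  assumes "additive_category C" and "exact_structure C D" and "exact_structure C E"
  shows
    "(enough_injectives C D \<longrightarrow>
       (\<forall>X\<in>obj C.
          (divisible_object C D E X \<longleftrightarrow>
             (\<exists>(i, d)\<in>E. src C i = X \<and> injective_object C D (tgt C i))) \<and>
          (divisible_object C D E X \<longleftrightarrow>
             (\<exists>(i, d)\<in>E. src C i = X \<and> divisible_object C D E (tgt C i))) \<and>
          (\<forall>\<M>. injectively_generated C D E \<M> \<longrightarrow>
             (divisible_object C D E X \<longleftrightarrow>
                (\<forall>M\<in>\<M>. \<forall>f\<in>Hom C X M. \<exists>I. injective_object C D I \<and> factors_through C f I)))))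
     \<and>
     (enough_projectives C D \<longrightarrow>
       (\<forall>Z\<in>obj C.
          (flat_object C D E Z \<longleftrightarrow>
             (\<exists>(i, d)\<in>E. tgt C d = Z \<and> projective_object C D (src C d))) \<and>
          (flat_object C D E Z \<longleftrightarrow>
             (\<exists>(i, d)\<in>E. tgt C d = Z \<and> flat_object C D E (src C d))) \<and>
          (\<forall>\<M>. projectively_generated C D E \<M> \<longrightarrow>
             (flat_object C D E Z \<longleftrightarrow>
                (\<forall>M\<in>\<M>. \<forall>f\<in>Hom C M Z. \<exists>P. projective_object C D P \<and> factors_through C f P)))))"
proof -
  interpret exact_category_pair C D E
    using assms by (intro exact_category_pair.intro exact_category.intro exact_category_axioms.intro)
  \<comment> \<open>The results on flat objects, read in the opposite category, are those on
    divisible objects; rewriting with the duality equations is all that is left.\<close>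
  interpret op: exact_category_pair "opcat C" "D\<inverse>" "E\<inverse>" by (rule exact_category_pair_opcat)
  have conv: "(\<exists>(i, d)\<in>E\<inverse>. P i d) \<longleftrightarrow> (\<exists>(i, d)\<in>E. P d i)" for P by auto
  show ?thesis
    using flat_iff_conflation_projective flat_iff_conflation_flat flat_iff_factors_through_projective
      op.flat_iff_conflation_projective op.flat_iff_conflation_flat
      op.flat_iff_factors_through_projective
    unfolding conv opcat_simps flat_object_opcat projective_object_opcat enough_projectives_opcat
      D.projectively_generated_opcat factors_through_opcat Hom_opcat
    by (intro conjI impI ballI allI) assumption+
qed

end
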